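(* Let $\dot A$ be a non-negative symmetric Schrödinger operator as described in the context, with deficiency indices $(1,1)$, such that $m_\infty(-0)$ is finite and $m_\infty(-0)\ge0$. Let $\alpha\in(0,\pi]$ and let $\Theta_{\tan\alpha,i}$ be the Schrödinger L-system whose impedance function is $-m_\alpha$. Then $\Theta_{\tan\alpha,i}$ is accretive if and only if $\tan\alpha\ge\frac{1}{m_\infty(-0)}$ (with the conventions $1/0=+\infty$ and $\tan(\pi/2)=+\infty$).
   Context: Setting. Let $\ell\ge0$ and let $q$ be a real-valued locally summable function on $[\ell,\infty)$; put $l(y)=-y''+q(x)y$. In $\mathcal H=L^2[\ell,\infty)$ let $\dot A$ be the minimal symmetric operator $\dot Ay=l(y)$ with boundary conditions $y(\ell)=y'(\ell)=0$; it is assumed that $\dot A$ has deficiency indices $(1,1)$ and is non-negative: $(\dot Ay,y)\ge0$ for $y\in\mathrm{dom}(\dot A)$. Let $\mathcal H_+=\mathrm{dom}(\dot A^* )$ with inner product $(y,z)_+=\int_\ell^\infty(y\bar z+l(y)\overline{l(z)})\,dx$, and let $\mathcal H_+\subset L^2[\ell,\infty)\subset\mathcal H_-$ be the associated rigged Hilbert space; $\delta(x-\ell),\delta'(x-\ell)\in\mathcal H_-$ act by $(y,\delta(x-\ell))=y(\ell)$, $(y,\delta'(x-\ell))=-y'(\ell)$. Weyl–Titchmarsh functions. For $z\in\mathbb C\setminus\mathbb R$ let $\varphi_1,\varphi_2$ solve $l(\varphi)=z\varphi$ with $\varphi_1(\ell)=0,\varphi_1'(\ell)=1$, $\varphi_2(\ell)=-1,\varphi_2'(\ell)=0$;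 $m_\infty(z)$ is the unique number such that $\varphi_2+m_\infty(z)\varphi_1\in L^2[\ell,\infty)$. For $\alpha\in\mathbb R$ put $m_\alpha(z)=\frac{\sin\alpha+m_\infty(z)\cos\alpha}{\cos\alpha-m_\infty(z)\sin\alpha}$. For non-negative $\dot A$, $m_\infty(-0)=\lim_{x\uparrow0}m_\infty(x)$ denotes the limit of $m_\infty$ at $0$ from the left along the negative real axis. Schrödinger L-systems. For $h\in\mathbb C$ with $\operatorname{Im}h>0$ and $\mu\in\mathbb R\cup\{\infty\}$, the Schrödinger L-system $\Theta_{\mu,h}$ consists of the rigged space above, the main operator $T_hy=l(y)$ on $\{y\in\mathcal H_+: y'(\ell)=hy(\ell)\}$, the state-space operator $\mathbb A_{\mu,h}:\mathcal H_+\to\mathcal H_-$, $\mathbb A_{\mu,h}y=l(y)-\frac1{\mu-h}[y'(\ell)-hy(\ell)][\mu\delta(x-\ell)+\delta'(x-\ell)]$ (for $\mu=\infty$: $l(y)-[y'(\ell)-hy(\ell)]\delta(x-\ell)$), and the channel operator $K_{\mu,h}c=c\,g_{\mu,h}$, $g_{\mu,h}=\frac{(\operatorname{Im}h)^{1/2}}{|\mu-h|}[\mu\delta(x-\ell)+\delta'(x-\ell)]$ (for $\mu=\infty$: $(\operatorname{Im}h)^{1/2}\delta(x-\ell)$). Its impedance function $V_\Theta(z)=K^*(\operatorname{Re}\mathbb A-zI)^{-1}K$ is known to equal $\frac{(m_\infty(z)+\mu)\operatorname{Im}h}{(\mu-\operatorname{Re}h)m_\infty(z)+\mu\operatorname{Re}h-|h|^2}$;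 in particular $V_{\Theta_{\tan\alpha,i}}=-m_\alpha$. An L-system is called accretive if its state-space operator satisfies $\operatorname{Re}(\mathbb Ay,y)\ge0$ for all $y\in\mathcal H_+$ (pairing between $\mathcal H_-$ and $\mathcal H_+$). *)

theory Defs
  imports "HOL-Analysis.Analysis"
begin

text \<open>Functions on the half-line [l, infinity) are represented as functions real => complex;
  only their values on {l..} matter.\<close>

definition loc_int :: "real \<Rightarrow> (real \<Rightarrow> 'a::{banach,second_countable_topology}) \<Rightarrow> bool" where
  "loc_int l f \<longleftrightarrow> (\<forall>b. set_integrable lborel {l..b} f)"

definition L2 :: "real \<Rightarrow> (real \<Rightarrow> complex) \<Rightarrow> bool" where
  "L2 l f \<longleftrightarrow> set_borel_measurable lborel {l..} f
      \<and> set_integrable lborel {l..} (\<lambda>x. (cmod (f x))\<^sup>2)"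

text \<open>The differential expression l(y) = -y'' + q y, where w plays the role of y''.\<close>
definition lop :: "(real \<Rightarrow> real) \<Rightarrow> (real \<Rightarrow> complex) \<Rightarrow> (real \<Rightarrow> complex) \<Rightarrow> real \<Rightarrow> complex" where
  "lop q y w x = - w x + complex_of_real (q x) * y x"

text \<open>y belongs to H_+ = dom(A*) (maximal domain), with quasi-derivative p = y' and w = y'':
  y and y' are locally absolutely continuous on [l, infinity), y and l(y) are in L^2.\<close>
definition dom_max :: "(real \<Rightarrow> real) \<Rightarrow> real \<Rightarrow> (real \<Rightarrow> complex) \<Rightarrow> (real \<Rightarrow> complex)
    \<Rightarrow> (real \<Rightarrow> complex) \<Rightarrow> bool" where
  "dom_max q l y p w \<longleftrightarrow> loc_int l p \<and> loc_int l w
     \<and> (\<forall>x\<ge>l. y x = y l + (LINT t:{l..x}|lborel. p t)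
              \<and> p x = p l + (LINT t:{l..x}|lborel. w t))
     \<and> L2 l y \<and> L2 l (lop q y w)"

definition ip :: "real \<Rightarrow> (real \<Rightarrow> complex) \<Rightarrow> (real \<Rightarrow> complex) \<Rightarrow> complex" where
  "ip l f g = (LINT x:{l..}|lborel. f x * cnj (g x))"

definition nonneg_min :: "(real \<Rightarrow> real) \<Rightarrow> real \<Rightarrow> bool" where
  "nonneg_min q l \<longleftrightarrow> (\<forall>y p w. dom_max q l y p w \<and> y l = 0 \<and> p l = 0 \<longrightarrow>
      Im (ip l (lop q y w) y) = 0 \<and> 0 \<le> Re (ip l (lop q y w) y))"

definition defect_space :: "(real \<Rightarrow> real) \<Rightarrow> real \<Rightarrow> complex \<Rightarrow> (real \<Rightarrow> complex) set" where
  "defect_space q l z = {y. \<exists>p w. dom_max q l y p w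
      \<and> (AE x in lborel. l \<le> x \<longrightarrow> lop q y w x = z * y x)}"

definition dim_one :: "real \<Rightarrow> (real \<Rightarrow> complex) set \<Rightarrow> bool" where
  "dim_one l S \<longleftrightarrow> (\<exists>\<phi>\<in>S. (\<exists>x\<ge>l. \<phi> x \<noteq> 0) \<and> (\<forall>\<psi>\<in>S. \<exists>c. \<forall>x\<ge>l. \<psi> x = c * \<phi> x))"

definition deficiency_1_1 :: "(real \<Rightarrow> real) \<Rightarrow> real \<Rightarrow> bool" where
  "deficiency_1_1 q l \<longleftrightarrow> dim_one l (defect_space q l \<i>) \<and> dim_one l (defect_space q l (- \<i>))"

definition is_sol :: "(real \<Rightarrow> real) \<Rightarrow> real \<Rightarrow> complex \<Rightarrow> (real \<Rightarrow> complex) \<Rightarrow> (real \<Rightarrow> complex) \<Rightarrow> bool" where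
  "is_sol q l z y p \<longleftrightarrow> loc_int l p \<and> loc_int l (\<lambda>t. (complex_of_real (q t) - z) * y t)
     \<and> (\<forall>x\<ge>l. y x = y l + (LINT t:{l..x}|lborel. p t)
              \<and> p x = p l + (LINT t:{l..x}|lborel. (complex_of_real (q t) - z) * y t))"

definition m_inf :: "(real \<Rightarrow> real) \<Rightarrow> real \<Rightarrow> complex \<Rightarrow> complex" where
  "m_inf q l z = (THE m. \<forall>\<phi>1 p1 \<phi>2 p2.
      is_sol q l z \<phi>1 p1 \<and> \<phi>1 l = 0 \<and> p1 l = 1 \<and>
      is_sol q l z \<phi>2 p2 \<and> \<phi>2 l = -1 \<and> p2 l = 0 \<longrightarrow> L2 l (\<lambda>x. \<phi>2 x + m * \<phi>1 x))"

text \<open>(A_{mu,h} y, y) for the state-space operator of the Schroedinger L-system Theta_{mu,h},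
  using (delta, y) = conj (y l) and (delta', y) = - conj (y' l); mu = infinity is encoded
  as the extended real PInfty.\<close>
definition state_form :: "(real \<Rightarrow> real) \<Rightarrow> real \<Rightarrow> ereal \<Rightarrow> complex \<Rightarrow> (real \<Rightarrow> complex)
    \<Rightarrow> (real \<Rightarrow> complex) \<Rightarrow> (real \<Rightarrow> complex) \<Rightarrow> complex" where
  "state_form q l \<mu> h y p w =
     (if \<mu> = \<infinity> then ip l (lop q y w) y - (p l - h * y l) * cnj (y l)
      else (let m = complex_of_real (real_of_ereal \<mu>) in
        ip l (lop q y w) y - (p l - h * y l) / (m - h) * (m * cnj (y l) - cnj (p l))))"

definition accretive_Lsys :: "(real \<Rightarrow> real) \<Rightarrow> real \<Rightarrow> ereal \<Rightarrow> complex \<Rightarrow> bool" where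
  "accretive_Lsys q l \<mu> h \<longleftrightarrow> (\<forall>y p w. dom_max q l y p w \<longrightarrow> 0 \<le> Re (state_form q l \<mu> h y p w))"

definition tan_ext :: "real \<Rightarrow> ereal" where
  "tan_ext a = (if cos a = 0 then \<infinity> else ereal (tan a))"

definition recip_ext :: "real \<Rightarrow> ereal" where
  "recip_ext x = (if x = 0 then \<infinity> else ereal (1 / x))"

end

theory Submission
  imports Defs
begin

text \<open>For \<open>z < 0\<close> let \<open>u\<close> be the Weyl solution with \<open>u(l) = -1\<close>, \<open>u'(l) = m\<^sub>\<infinity>(z)\<close>. Since the
  minimal operator is non-negative, so is the Dirichlet extension, and its form at \<open>y + y(l) u\<close> gives
  \<open>(l(y), y) \<ge> Re (y'(l) y(l)\<^sup>*) + m\<^sub>\<infinity>(z) |y(l)|\<^sup>2 + z \<parallel>y\<parallel>\<^sup>2\<close> by Green's formula. Letting \<open>z\<close> tend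
  to 0, the real part of the state form is bounded below by a quadratic form in \<open>(y(l), y'(l))\<close>,
  which for finite \<open>\<mu> = tan \<alpha>\<close> is positive semidefinite iff \<open>\<mu> M \<ge> 1\<close>. Conversely, for
  \<open>0 \<le> \<mu>\<close> and \<open>\<mu> M < 1\<close> the Weyl solutions violate accretivity, and for \<open>\<mu> < 0\<close> functions
  concentrated at the endpoint do.

  The existence of \<open>u\<close> for \<open>z < 0\<close> is proved directly from the lower bound of the Dirichlet
  extension, which keeps the minimal norm of \<open>\<phi>\<^sub>2 + m \<phi>\<^sub>1\<close> on \<open>[l, N]\<close> bounded as \<open>N\<close> grows.\<close>

section \<open>Primitives of locally integrable functions\<close>

definition primitive :: "real \<Rightarrow> (real \<Rightarrow> real) \<Rightarrow> (real \<Rightarrow> real) \<Rightarrow> bool" where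
  "primitive l F f \<longleftrightarrow> loc_int l f \<and> (\<forall>x\<ge>l. F x = F l + (LINT t:{l..x}|lborel. f t))"

lemma set_integral_singleton [simp]:
  fixes f :: "real \<Rightarrow> real"
  shows "(LINT t:{l}|lborel. f t) = 0"
  unfolding set_lebesgue_integral_def
  by (rule integral_eq_zero_AE) (use AE_lborel_singleton[of l] in eventually_elim, auto)

lemma loc_int_set_integrable: "loc_int l f \<Longrightarrow> set_integrable lborel {l..b} f"
  by (simp add: loc_int_def)

lemma loc_int_add: "loc_int l f \<Longrightarrow> loc_int l g \<Longrightarrow> loc_int l (\<lambda>x. f x + g x)"
  by (simp add: loc_int_def)

lemma loc_int_diff: "loc_int l f \<Longrightarrow> loc_int l g \<Longrightarrow> loc_int l (\<lambda>x. f x - g x)"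
  by (simp add: loc_int_def)

lemma loc_int_cmult: "loc_int l f \<Longrightarrow> loc_int l (\<lambda>x. c * f x)" for f :: "real \<Rightarrow> real"
  by (simp add: loc_int_def)

lemma loc_int_continuous:
  "continuous_on {l..} f \<Longrightarrow> loc_int l f" for f :: "real \<Rightarrow> real"
  unfolding loc_int_def by (auto intro!: borel_integrable_atLeastAtMost' elim: continuous_on_subset)

lemma loc_int_measurable:
  fixes f :: "real \<Rightarrow> real"
  assumes "loc_int l f"
  shows "set_borel_measurable lborel {l..} f"
proof -
  have 1: "(\<lambda>x. indicator {l..l + real n} x *\<^sub>R f x) \<in> borel_measurable lborel" for n
    using assms unfolding loc_int_def set_integrable_def by blast
  have "(\<lambda>n. indicator {l..l + real n} x *\<^sub>R f x) \<longlonglongrightarrow> indicator {l..} x *\<^sub>R f x" for x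
  proof (rule tendsto_eventually)
    obtain N :: nat where N: "x - l \<le> N" using real_arch_simple by blast
    show "\<forall>\<^sub>F n in sequentially. indicator {l..l + real n} x *\<^sub>R f x = indicator {l..} x *\<^sub>R f x"
      unfolding eventually_sequentially
    proof (intro exI[of _ N] allI impI)
      fix n assume "N \<le> n"
      with N have "x \<le> l + real n" by linarith
      then show "indicator {l..l + real n} x *\<^sub>R f x = indicator {l..} x *\<^sub>R f x"
        by (auto simp: indicator_def)
    qed
  qed
  then show ?thesis unfolding set_borel_measurable_def
    by (intro borel_measurable_LIMSEQ_real[OF _ 1]) auto
qed

lemma continuous_on_Icc_bounded:
  fixes f :: "real \<Rightarrow> real"
  assumes "continuous_on {l..} f"
  obtains C where "\<And>x. x \<in> {l..b} \<Longrightarrow> \<bar>f x\<bar> \<le> C"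
proof -
  have "continuous_on {l..b} f" using assms by (rule continuous_on_subset) auto
  then have "bounded (f ` {l..b})" by (intro compact_imp_bounded compact_continuous_image compact_Icc)
  then show ?thesis using that unfolding bounded_iff by (metis imageI real_norm_def)
qed

lemma loc_int_mult_continuous:
  fixes f g :: "real \<Rightarrow> real"
  assumes f: "loc_int l f" and g: "continuous_on {l..} g"
  shows "loc_int l (\<lambda>x. f x * g x)"
  unfolding loc_int_def
proof
  fix b
  have c: "continuous_on {l..b} g" using g by (rule continuous_on_subset) auto
  obtain C where C: "\<And>x. x \<in> {l..b} \<Longrightarrow> norm (g x) \<le> C"
    using continuous_on_Icc_bounded[OF g] by (metis real_norm_def)
  have i: "set_integrable lborel {l..b} (\<lambda>x. C * f x)"
    using loc_int_set_integrable[OF f] by simp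
  have m: "set_borel_measurable lborel {l..b} g"
    using borel_measurable_continuous_on_indicator[OF _ c] by (simp add: set_borel_measurable_def)
  have mf: "set_borel_measurable lborel {l..b} f"
    using loc_int_set_integrable[OF f, of b] unfolding set_integrable_def set_borel_measurable_def by blast
  have "(\<lambda>x. (indicator {l..b} x *\<^sub>R f x) * (indicator {l..b} x *\<^sub>R g x)) \<in> borel_measurable lborel"
    using m mf unfolding set_borel_measurable_def by (rule borel_measurable_times[rotated])
  also have "(\<lambda>x. (indicator {l..b} x *\<^sub>R f x) * (indicator {l..b} x *\<^sub>R g x)) 
     = (\<lambda>x. indicator {l..b} x *\<^sub>R (f x * g x))" by (auto simp: indicator_def)
  finally have mm: "set_borel_measurable lborel {l..b} (\<lambda>x. f x * g x)"
    unfolding set_borel_measurable_def .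
  show "set_integrable lborel {l..b} (\<lambda>x. f x * g x)"
  proof (rule set_integrable_bound[OF i mm])
    show "AE x in lborel. x \<in> {l..b} \<longrightarrow> norm (f x * g x) \<le> norm (C * f x)"
    proof (intro AE_I2 impI)
      fix x assume "x \<in> {l..b}"
      then have "norm (g x) \<le> \<bar>C\<bar>" using C by force
      then show "norm (f x * g x) \<le> norm (C * f x)"
        by (simp add: abs_mult mult.commute[of "\<bar>C\<bar>"] mult_left_mono)
    qed
  qed
qed

lemma primitive_integral: "primitive l F f \<Longrightarrow> l \<le> x \<Longrightarrow> (LINT t:{l..x}|lborel. f t) = F x - F l"
  unfolding primitive_def by (metis add_diff_cancel_left')

lemma primitive_loc_int: "primitive l F f \<Longrightarrow> loc_int l f"
  by (simp add: primitive_def)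

lemma primitive_add:
  assumes "primitive l F f" "primitive l G g"
  shows "primitive l (\<lambda>x. F x + G x) (\<lambda>x. f x + g x)"
  unfolding primitive_def
proof (intro conjI allI impI)
  have i: "loc_int l f" "loc_int l g" using assms by (auto intro: primitive_loc_int)
  then show "loc_int l (\<lambda>x. f x + g x)" by (rule loc_int_add)
  fix x assume x: "l \<le> x"
  have "(LINT t:{l..x}|lborel. f t + g t) = (F x - F l) + (G x - G l)"
    using set_integral_add(2)[OF i[THEN loc_int_set_integrable]]
    by (simp add: primitive_integral[OF _ x, OF assms(1)] primitive_integral[OF _ x, OF assms(2)])
  then show "F x + G x = F l + G l + (LINT t:{l..x}|lborel. f t + g t)" by simp
qed

lemma primitive_cmult:
  assumes "primitive l F f"
  shows "primitive l (\<lambda>x. c * F x) (\<lambda>x. c * f x)"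
  unfolding primitive_def
proof (intro conjI allI impI)
  show "loc_int l (\<lambda>x. c * f x)" by (intro loc_int_cmult primitive_loc_int[OF assms])
  fix x assume x: "l \<le> x"
  have "(LINT t:{l..x}|lborel. c * f t) = c * (F x - F l)"
    by (simp add: primitive_integral[OF assms x])
  then show "c * F x = c * F l + (LINT t:{l..x}|lborel. c * f t)" by (simp add: algebra_simps)
qed

lemma set_integral_continuous_on:
  fixes f :: "real \<Rightarrow> real"
  assumes "loc_int l f"
  shows "continuous_on {l..} (\<lambda>x. LINT t:{l..x}|lborel. f t)"
proof -
  let ?F = "\<lambda>x. LINT t:{l..x}|lborel. f t"
  note i = loc_int_set_integrable[OF assms]
  have c: "continuous_on {l..b} ?F" for b
    using indefinite_integral_continuous_1[OF set_borel_integral_eq_integral(1)[OF i[of b]]]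
    unfolding set_borel_integral_eq_integral(2)[OF i] .
  show ?thesis
    unfolding continuous_on_eq_continuous_within
  proof
    fix x assume x: "x \<in> {l..}"
    have "continuous (at x within {l..x + 1}) ?F"
      using c[of "x + 1"] x by (simp add: continuous_on_eq_continuous_within)
    moreover have "at x within {l..x + 1} = at x within {l..}"
    proof (rule at_within_nhd[of _ "{..<x + 1}"])
      show "{l..x + 1} \<inter> {..<x + 1} - {x} = {l..} \<inter> {..<x + 1} - {x}"
        by (intro set_eqI) auto
    qed simp_all
    ultimately show "continuous (at x within {l..}) ?F" by simp
  qed
qed

lemma primitive_continuous:
  assumes "primitive l F f"
  shows "continuous_on {l..} F"
proof -
  have "continuous_on {l..} (\<lambda>x. F l + (LINT t:{l..x}|lborel. f t))"
    by (intro continuous_on_add continuous_on_const set_integral_continuous_on primitive_loc_int[OF assms])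
  then show ?thesis
    by (rule continuous_on_eq) (simp add: primitive_integral[OF assms])
qed

lemma primitive_deriv:
  assumes "\<And>x. l \<le> x \<Longrightarrow> (F has_real_derivative f x) (at x)" and "continuous_on {l..} f"
  shows "primitive l F f"
  unfolding primitive_def
proof (intro conjI allI impI)
  show "loc_int l f" by (rule loc_int_continuous) fact
  fix x assume x: "l \<le> x"
  have "(LINT t:{l..x}|lborel. f t) = F x - F l"
    unfolding set_lebesgue_integral_def
  proof (rule integral_FTC_atLeastAtMost[OF x])
    show "continuous_on {l..x} f" by (rule continuous_on_subset[OF assms(2)]) auto
    show "(F has_vector_derivative f t) (at t within {l..x})" if "l \<le> t" "t \<le> x" for t
      using assms(1)[OF that(1)] has_real_derivative_iff_has_vector_derivative
        has_vector_derivative_at_within by blast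
  qed
  then show "F x = F l + (LINT t:{l..x}|lborel. f t)" by simp
qed

text \<open>Integration by parts without derivatives: by Fubini the left side is the integral of
  \<open>f s * g t\<close> over a square, and the two terms on the right are the parts with t \<le>
  s and with s < t.\<close>

lemma set_integral_product:
  fixes f g :: "real \<Rightarrow> real"
  assumes f: "loc_int l f" and g: "loc_int l g"
  shows "(LINT t:{l..x}|lborel. f t) * (LINT t:{l..x}|lborel. g t) =
    (LINT s:{l..x}|lborel. f s * (LINT t:{l..s}|lborel. g t)) +
    (LINT t:{l..x}|lborel. (LINT s:{l..t}|lborel. f s) * g t)"
proof -
  define f1 where "f1 = (\<lambda>s. indicator {l..x} s * f s)"
  define g1 where "g1 = (\<lambda>s. indicator {l..x} s * g s)"
  have f1: "integrable lborel f1"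
    using loc_int_set_integrable[OF f, of x] unfolding f1_def set_integrable_def by simp
  have g1: "integrable lborel g1"
    using loc_int_set_integrable[OF g, of x] unfolding g1_def set_integrable_def by simp
  have [measurable]: "f1 \<in> borel_measurable borel" "g1 \<in> borel_measurable borel"
    using borel_measurable_integrable[OF f1] borel_measurable_integrable[OF g1] by simp_all
  have I: "integrable (lborel \<Otimes>\<^sub>M lborel) (\<lambda>(s,t). f1 s * g1 t)"
  proof (rule lborel_pair.Fubini_integrable)
    show "integrable lborel (\<lambda>s. \<integral>t. norm (case (s, t) of (s, t) \<Rightarrow> f1 s * g1 t) \<partial>lborel)"
      using integrable_norm[OF f1] by (simp add: abs_mult)
    show "AE s in lborel. integrable lborel (\<lambda>t. case (s, t) of (s, t) \<Rightarrow> f1 s * g1 t)"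
      using g1 by simp
  qed simp
  define P where "P = (\<lambda>(s,t). f1 s * g1 t * indicator {..s} t)"
  define Q where "Q = (\<lambda>(s,t). f1 s * g1 t * indicator {..<t} s)"
  have cl: "closed {z::real\<times>real. snd z \<le> fst z}"
    by (intro closed_Collect_le continuous_intros)
  have op: "open {z::real\<times>real. fst z < snd z}"
    by (intro open_Collect_less continuous_intros)
  have ms: "{z::real\<times>real. snd z \<le> fst z} \<in> sets (lborel \<Otimes>\<^sub>M lborel)"
    "{z::real\<times>real. fst z < snd z} \<in> sets (lborel \<Otimes>\<^sub>M lborel)"
    unfolding lborel_prod sets_lborel using borel_closed[OF cl] borel_open[OF op] by auto
  have P': "P = (\<lambda>z. indicator {z. snd z \<le> fst z} z *\<^sub>R (case z of (s,t) \<Rightarrow> f1 s * g1 t))"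
    by (auto simp: P_def indicator_def)
  have Q': "Q = (\<lambda>z. indicator {z. fst z < snd z} z *\<^sub>R (case z of (s,t) \<Rightarrow> f1 s * g1 t))"
    by (auto simp: Q_def indicator_def)
  have IP: "integrable (lborel \<Otimes>\<^sub>M lborel) P"
    unfolding P' by (rule integrable_mult_indicator[OF _ I]) (use ms in blast)
  have IQ: "integrable (lborel \<Otimes>\<^sub>M lborel) Q"
    unfolding Q' by (rule integrable_mult_indicator[OF _ I]) (use ms in blast)
  have "(LINT t:{l..x}|lborel. f t) * (LINT t:{l..x}|lborel. g t) = (\<integral>s. \<integral>t. f1 s * g1 t \<partial>lborel \<partial>lborel)"
    by (simp add: f1_def g1_def set_lebesgue_integral_def)
  also have "\<dots> = (\<integral>z. (case z of (s,t) \<Rightarrow> f1 s * g1 t) \<partial>(lborel \<Otimes>\<^sub>M lborel))"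
    using lborel_pair.integral_fst'[OF I] by simp
  also have "\<dots> = (\<integral>z. P z + Q z \<partial>(lborel \<Otimes>\<^sub>M lborel))"
    by (intro Bochner_Integration.integral_cong) (auto simp: P_def Q_def indicator_def)
  also have "\<dots> = (\<integral>z. P z \<partial>(lborel \<Otimes>\<^sub>M lborel)) + (\<integral>z. Q z \<partial>(lborel \<Otimes>\<^sub>M lborel))"
    using IP IQ by simp
  also have "(\<integral>z. P z \<partial>(lborel \<Otimes>\<^sub>M lborel)) = (\<integral>s. \<integral>t. f1 s * g1 t * indicator {..s} t \<partial>lborel \<partial>lborel)"
    using lborel_pair.integral_fst[of "\<lambda>s t. f1 s * g1 t * indicator {..s} t"] IP unfolding P_def by simp
  also have "\<dots> = (LINT s:{l..x}|lborel. f s * (LINT t:{l..s}|lborel. g t))"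
    unfolding set_lebesgue_integral_def
  proof (intro Bochner_Integration.integral_cong refl)
    fix s
    have "(\<integral>t. f1 s * g1 t * indicator {..s} t \<partial>lborel) = f1 s * (\<integral>t. g1 t * indicator {..s} t \<partial>lborel)"
      by (simp add: mult.assoc)
    also have "\<dots> = indicator {l..x} s *\<^sub>R (f s * (\<integral>t. indicator {l..s} t *\<^sub>R g t \<partial>lborel))"
    proof (cases "s \<in> {l..x}")
      case True
      have "(\<lambda>t. g1 t * indicator {..s} t) = (\<lambda>t. indicator {l..s} t *\<^sub>R g t)"
        using True by (auto simp: g1_def indicator_def)
      then show ?thesis using True by (simp add: f1_def)
    qed (simp add: f1_def)
    finally show "(\<integral>t. f1 s * g1 t * indicator {..s} t \<partial>lborel) =
      indicator {l..x} s *\<^sub>R (f s * (\<integral>t. indicator {l..s} t *\<^sub>R g t \<partial>lborel))" .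
  qed
  also have "(\<integral>z. Q z \<partial>(lborel \<Otimes>\<^sub>M lborel)) = (\<integral>t. \<integral>s. f1 s * g1 t * indicator {..<t} s \<partial>lborel \<partial>lborel)"
    using lborel_pair.integral_snd[of "\<lambda>s t. f1 s * g1 t * indicator {..<t} s"] IQ unfolding Q_def by simp
  also have "\<dots> = (LINT t:{l..x}|lborel. (LINT s:{l..t}|lborel. f s) * g t)"
    unfolding set_lebesgue_integral_def
  proof (intro Bochner_Integration.integral_cong refl)
    fix t
    have "(\<integral>s. f1 s * g1 t * indicator {..<t} s \<partial>lborel) = (\<integral>s. g1 t * (f1 s * indicator {..<t} s) \<partial>lborel)"
      by (simp add: mult_ac)
    also have "\<dots> = g1 t * (\<integral>s. f1 s * indicator {..<t} s \<partial>lborel)"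
      by simp
    also have "\<dots> = indicator {l..x} t *\<^sub>R ((\<integral>s. indicator {l..t} s *\<^sub>R f s \<partial>lborel) * g t)"
    proof (cases "t \<in> {l..x}")
      case True
      \<comment> \<open>\<open>Q\<close> leaves out the diagonal, whereas the target integral runs
        up to and including t; the one point is a null set.\<close>
      have "AE s in lborel. s \<noteq> t" by (rule AE_lborel_singleton)
      then have "AE s in lborel. f1 s * indicator {..<t} s = indicator {l..t} s *\<^sub>R f s"
        by eventually_elim (use True in \<open>auto simp: f1_def indicator_def\<close>)
      moreover have "(\<lambda>s. indicator {l..t} s *\<^sub>R f s) \<in> borel_measurable lborel"
        using f unfolding loc_int_def set_integrable_def by blast
      ultimately have "(\<integral>s. f1 s * indicator {..<t} s \<partial>lborel) = (\<integral>s. indicator {l..t} s *\<^sub>R f s \<partial>lborel)"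
        by (intro integral_cong_AE) auto
      then show ?thesis using True by (simp add: g1_def)
    qed (simp add: g1_def)
    finally show "(\<integral>s. f1 s * g1 t * indicator {..<t} s \<partial>lborel) =
      indicator {l..x} t *\<^sub>R ((\<integral>s. indicator {l..t} s *\<^sub>R f s \<partial>lborel) * g t)" .
  qed
  finally show ?thesis .
qed

text \<open>Each factor is its value at \<open>l\<close> plus an integral. The constants contribute
  linear terms, and only the product of the two integrals needs Fubini.\<close>

lemma primitive_mult:
  assumes F: "primitive l F f" and G: "primitive l G g"
  shows "primitive l (\<lambda>x. F x * G x) (\<lambda>x. f x * G x + F x * g x)"
  unfolding primitive_def
proof (intro conjI allI impI)
  note f = primitive_loc_int[OF F] and g = primitive_loc_int[OF G]
  note cF = primitive_continuous[OF F] and cG = primitive_continuous[OF G]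
  have i1: "loc_int l (\<lambda>x. f x * G x)" by (rule loc_int_mult_continuous[OF f cG])
  have i2: "loc_int l (\<lambda>x. F x * g x)"
    using loc_int_mult_continuous[OF g cF] by (simp add: mult.commute)
  show "loc_int l (\<lambda>x. f x * G x + F x * g x)" by (rule loc_int_add[OF i1 i2])
  fix x assume x: "l \<le> x"
  define If where "If = (\<lambda>s. LINT t:{l..s}|lborel. f t)"
  define Ig where "Ig = (\<lambda>s. LINT t:{l..s}|lborel. g t)"
  have 1: "(LINT t:{l..x}|lborel. f t * G t) = G l * If x + (LINT t:{l..x}|lborel. f t * Ig t)"
  proof -
    have "(LINT t:{l..x}|lborel. f t * G t) = (LINT t:{l..x}|lborel. G l * f t + f t * Ig t)"
      by (rule set_lebesgue_integral_cong) (auto simp: primitive_integral[OF G] Ig_def algebra_simps)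
    also have "\<dots> = (LINT t:{l..x}|lborel. G l * f t) + (LINT t:{l..x}|lborel. f t * Ig t)"
      by (rule set_integral_add)
        (use loc_int_mult_continuous[OF f set_integral_continuous_on[OF g]] f in
          \<open>simp_all add: loc_int_def Ig_def\<close>)
    finally show ?thesis by (simp add: If_def)
  qed
  have 2: "(LINT t:{l..x}|lborel. F t * g t) = F l * Ig x + (LINT t:{l..x}|lborel. If t * g t)"
  proof -
    have "(LINT t:{l..x}|lborel. F t * g t) = (LINT t:{l..x}|lborel. F l * g t + If t * g t)"
      by (rule set_lebesgue_integral_cong) (auto simp: primitive_integral[OF F] If_def algebra_simps)
    also have "\<dots> = (LINT t:{l..x}|lborel. F l * g t) + (LINT t:{l..x}|lborel. If t * g t)"
      by (rule set_integral_add)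
        (use loc_int_mult_continuous[OF g set_integral_continuous_on[OF f]] g in
          \<open>simp_all add: loc_int_def If_def mult.commute\<close>)
    finally show ?thesis by (simp add: Ig_def)
  qed
  have "(LINT t:{l..x}|lborel. f t * G t + F t * g t)
      = (LINT t:{l..x}|lborel. f t * G t) + (LINT t:{l..x}|lborel. F t * g t)"
    using i1 i2 by (simp add: loc_int_def)
  also have "\<dots> = G l * If x + F l * Ig x + If x * Ig x"
    using set_integral_product[OF f g, of x] unfolding 1 2 If_def Ig_def by simp
  also have "\<dots> = F x * G x - F l * G l"
    unfolding If_def Ig_def primitive_integral[OF F x] primitive_integral[OF G x]
    by (simp add: algebra_simps)
  finally show "F x * G x = F l * G l + (LINT t:{l..x}|lborel. f t * G t + F t * g t)" by simp
qed

section \<open>Linear equations with locally integrable coefficients\<close>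

lemma summable_exp_cmult: "summable (\<lambda>n. C * x ^ n / fact n)" for x C :: real
  using summable_mult[OF summable_exp[of x], of C] by (simp add: field_simps)

lemma primitive_power:
  assumes K: "primitive l K k"
  shows "primitive l (\<lambda>x. K x ^ Suc n) (\<lambda>x. real (Suc n) * (k x * K x ^ n))"
proof (induction n)
  case 0
  then show ?case using K by simp
next
  case (Suc n)
  have "(\<lambda>x. real (Suc (Suc n)) * (k x * K x ^ Suc n)) =
      (\<lambda>x. k x * K x ^ Suc n + K x * (real (Suc n) * (k x * K x ^ n)))"
    by (auto simp: algebra_simps)
  then show ?case using primitive_mult[OF K Suc] by simp
qed

text \<open>The terms are the increments of successive approximation for y' = p, p' = g y - f, so
  the solution is their sum and not their limit. Initial data and inhomogeneity enter through the
  zeroth term \<open>s\<close> alone.\<close>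

primrec picard :: "real \<Rightarrow> (real \<Rightarrow> real) \<Rightarrow> (real \<Rightarrow> real) \<times> (real \<Rightarrow> real) \<Rightarrow> nat
    \<Rightarrow> (real \<Rightarrow> real) \<times> (real \<Rightarrow> real)" where
  "picard l g s 0 = s"
| "picard l g s (Suc n) = (\<lambda>x. LINT t:{l..x}|lborel. snd (picard l g s n) t,
     \<lambda>x. LINT t:{l..x}|lborel. g t * fst (picard l g s n) t)"

text \<open>On a compact interval the n-th increment is at most C K^n / n!, where \<open>K\<close>
  is the primitive of a locally integrable weight. The exponential series thus gives both
  convergence and the exchange of sum and integral.\<close>

lemma linear_ode_exists:
  fixes g f :: "real \<Rightarrow> real"
  assumes g: "loc_int l g" and f: "loc_int l f"
  obtains y p where "y l = a" "p l = b" "primitive l y p" "primitive l p (\<lambda>t. g t * y t - f t)"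
proof -
  \<comment> \<open>The 1 pays for y' = p and |g| for p' = g y, so that one weight serves both
    components.\<close>
  define k where "k = (\<lambda>t. 1 + \<bar>g t\<bar>)"
  define K where "K = (\<lambda>x. LINT t:{l..x}|lborel. k t)"
  have k: "loc_int l k"
    unfolding k_def
  proof (rule loc_int_add)
    show "loc_int l (\<lambda>t. \<bar>g t\<bar>)" using g unfolding loc_int_def by (blast intro: set_integrable_abs)
  qed (intro loc_int_continuous continuous_on_const)
  have K0: "K l = 0" by (simp add: K_def)
  have pK: "primitive l K k"
    unfolding primitive_def using k K0 by (simp add: K_def)
  have Knn: "0 \<le> K x" for x
    unfolding K_def set_lebesgue_integral_def by (rule integral_nonneg_AE) (auto simp: k_def)
  \<comment> \<open>Since \<open>K l = 0\<close>, K^(n+1) / (n+1)! is the integral of k K^n / n!: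
    each integration in the recursion raises n by one.\<close>
  have Kint: "set_integrable lborel {l..x} (\<lambda>t. k t * (C * K t ^ n / fact n))"
    "l \<le> x \<Longrightarrow> (LINT t:{l..x}|lborel. k t * (C * K t ^ n / fact n)) = C * K x ^ Suc n / fact (Suc n)"
    for C x n
  proof -
    have eq: "(\<lambda>t. k t * (C * K t ^ n / fact n)) =
      (\<lambda>t. C / fact (Suc n) * (real (Suc n) * (k t * K t ^ n)))"
      by (rule ext) (simp add: fact_Suc del: of_nat_Suc)
    note pp = primitive_cmult[OF primitive_power[OF pK, of n], of "C / fact (Suc n)"]
    show "set_integrable lborel {l..x} (\<lambda>t. k t * (C * K t ^ n / fact n))"
      unfolding eq by (rule loc_int_set_integrable[OF primitive_loc_int[OF pp]])
    show "(LINT t:{l..x}|lborel. k t * (C * K t ^ n / fact n)) = C * K x ^ Suc n / fact (Suc n)"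
      if "l \<le> x"
      unfolding eq using primitive_integral[OF pp that] by (simp add: K0)
  qed
  have step: "(LINT t:{l..x}|lborel. \<bar>h t\<bar>) \<le> C * K x ^ Suc n / fact (Suc n)"
    "\<bar>LINT t:{l..x}|lborel. h t\<bar> \<le> C * K x ^ Suc n / fact (Suc n)"
    if h: "loc_int l h" and x: "l \<le> x"
      and bd: "\<And>t. t \<in> {l..x} \<Longrightarrow> \<bar>h t\<bar> \<le> k t * (C * K t ^ n / fact n)" for h x C n
  proof -
    show 1: "(LINT t:{l..x}|lborel. \<bar>h t\<bar>) \<le> C * K x ^ Suc n / fact (Suc n)"
      unfolding Kint(2)[OF x, symmetric]
      by (intro set_integral_mono set_integrable_abs loc_int_set_integrable h Kint(1) bd)
    have "\<bar>LINT t:{l..x}|lborel. h t\<bar> \<le> (LINT t:{l..x}|lborel. \<bar>h t\<bar>)"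
      using set_integral_norm_bound[OF loc_int_set_integrable[OF h, of x]] by simp
    with 1 show "\<bar>LINT t:{l..x}|lborel. h t\<bar> \<le> C * K x ^ Suc n / fact (Suc n)" by simp
  qed
  have swap: "set_integrable lborel {l..x} (\<lambda>t. \<Sum>n. h n t)"
    "(LINT t:{l..x}|lborel. (\<Sum>n. h n t)) = (\<Sum>n. LINT t:{l..x}|lborel. h n t)"
    if h: "\<And>n. loc_int l (h n)" and x: "l \<le> x"
      and bd: "\<And>n t. t \<in> {l..x} \<Longrightarrow> \<bar>h n t\<bar> \<le> k t * (C * K t ^ n / fact n)" for h x C
  proof -
    let ?F = "\<lambda>n t. indicator {l..x} t *\<^sub>R h n t"
    have i: "integrable lborel (?F n)" for n
      using loc_int_set_integrable[OF h] unfolding set_integrable_def .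
    have "summable (\<lambda>n. norm (?F n t))" for t
    proof (cases "t \<in> {l..x}")
      case True
      have "summable (\<lambda>n. k t * (C * K t ^ n / fact n))" by (intro summable_mult summable_exp_cmult)
      then show ?thesis
        by (rule summable_comparison_test'[where N = 0]) (use True bd in auto)
    qed simp
    then have ae: "AE t in lborel. summable (\<lambda>n. norm (?F n t))" by simp
    have "summable (\<lambda>n. \<integral>t. norm (?F n t) \<partial>lborel)"
    proof (rule summable_comparison_test'[where N = 0])
      show "summable (\<lambda>n. C * K x ^ Suc n / fact (Suc n))"
        using summable_exp_cmult[of C "K x"] by (subst summable_Suc_iff)
      show "norm (\<integral>t. norm (?F n t) \<partial>lborel) \<le> C * K x ^ Suc n / fact (Suc n)" for n
        using step(1)[OF h x bd, of n] by (simp add: set_lebesgue_integral_def abs_mult)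
    qed
    note s = this
    have eq: "(\<Sum>n. ?F n t) = indicator {l..x} t *\<^sub>R (\<Sum>n. h n t)" for t
      by (cases "t \<in> {l..x}") auto
    show "set_integrable lborel {l..x} (\<lambda>t. \<Sum>n. h n t)"
      using integrable_suminf[OF i ae s] unfolding eq set_integrable_def .
    show "(LINT t:{l..x}|lborel. (\<Sum>n. h n t)) = (\<Sum>n. LINT t:{l..x}|lborel. h n t)"
      using integral_suminf[OF i ae s] unfolding eq set_lebesgue_integral_def .
  qed
  define s where "s = (\<lambda>x::real. a, \<lambda>x. b - (LINT t:{l..x}|lborel. f t))"
  define Y where "Y = (\<lambda>n. fst (picard l g s n))"
  define P where "P = (\<lambda>n. snd (picard l g s n))"
  have Y0: "Y 0 = (\<lambda>x. a)" and P0: "P 0 = (\<lambda>x. b - (LINT t:{l..x}|lborel. f t))"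
    and YS: "Y (Suc n) = (\<lambda>x. LINT t:{l..x}|lborel. P n t)"
    and PS: "P (Suc n) = (\<lambda>x. LINT t:{l..x}|lborel. g t * Y n t)" for n
    by (simp_all add: Y_def P_def s_def)
  have cont: "continuous_on {l..} (Y n) \<and> continuous_on {l..} (P n)" for n
  proof (induction n)
    case 0
    then show ?case unfolding Y0 P0
      by (intro conjI continuous_on_const continuous_on_diff set_integral_continuous_on f)
  next
    case (Suc n)
    then show ?case unfolding YS PS
      by (intro conjI set_integral_continuous_on loc_int_continuous loc_int_mult_continuous g) auto
  qed
  have Pli: "loc_int l (P n)" for n using cont by (intro loc_int_continuous) auto
  have gYli: "loc_int l (\<lambda>t. g t * Y n t)" for n using cont g by (intro loc_int_mult_continuous) auto
  have bounds: "\<exists>C. \<forall>n. \<forall>x\<in>{l..N}. \<bar>Y n x\<bar> \<le> C * K x ^ n / fact n \<and> \<bar>P n x\<bar> \<le> C * K x ^ n / fact n" for N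
  proof -
    obtain C0 where C0: "\<And>x. x \<in> {l..N} \<Longrightarrow> \<bar>P 0 x\<bar> \<le> C0"
      using continuous_on_Icc_bounded conjunct2[OF cont] by metis
    \<comment> \<open>Dominates both \<open>Y 0\<close> and \<open>P 0\<close>; the absolute value
      around \<open>C0\<close> keeps it non-negative even if [l, N] is empty and \<open>C0\<close>
      arbitrary.\<close>
    define C where "C = \<bar>a\<bar> + \<bar>C0\<bar>"
    have "\<forall>x\<in>{l..N}. \<bar>Y n x\<bar> \<le> C * K x ^ n / fact n \<and> \<bar>P n x\<bar> \<le> C * K x ^ n / fact n" for n
    proof (induction n)
      case 0
      then show ?case using C0 by (force simp: Y0 C_def)
    next
      case (Suc n)
      show ?case
      proof
        fix x assume x: "x \<in> {l..N}"
        have nn: "0 \<le> C * K t ^ n / fact n" for t using Knn by (simp add: C_def)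
        have "\<bar>Y (Suc n) x\<bar> \<le> C * K x ^ Suc n / fact (Suc n)"
          unfolding YS
        proof (rule step(2)[OF Pli])
          fix t assume "t \<in> {l..x}"
          then have "\<bar>P n t\<bar> \<le> C * K t ^ n / fact n" using Suc x by auto
          also have "\<dots> \<le> k t * (C * K t ^ n / fact n)"
            using mult_right_mono[OF _ nn, of 1 "k t"] by (simp add: k_def)
          finally show "\<bar>P n t\<bar> \<le> k t * (C * K t ^ n / fact n)" .
        qed (use x in simp)
        moreover have "\<bar>P (Suc n) x\<bar> \<le> C * K x ^ Suc n / fact (Suc n)"
          unfolding PS
        proof (rule step(2)[OF gYli])
          fix t assume "t \<in> {l..x}"
          then have "\<bar>Y n t\<bar> \<le> C * K t ^ n / fact n" using Suc x by auto
          then show "\<bar>g t * Y n t\<bar> \<le> k t * (C * K t ^ n / fact n)"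
            unfolding abs_mult by (rule mult_mono[rotated]) (auto simp: k_def)
        qed (use x in simp)
        ultimately show "\<bar>Y (Suc n) x\<bar> \<le> C * K x ^ Suc n / fact (Suc n) \<and>
          \<bar>P (Suc n) x\<bar> \<le> C * K x ^ Suc n / fact (Suc n)" ..
      qed
    qed
    then show ?thesis by blast
  qed
  define y where "y = (\<lambda>x. \<Sum>n. Y n x)"
  define p where "p = (\<lambda>x. \<Sum>n. P n x)"
  have main: "set_integrable lborel {l..x} p" "y x = a + (LINT t:{l..x}|lborel. p t)"
    "set_integrable lborel {l..x} (\<lambda>t. g t * y t)"
    "p x = b + (LINT t:{l..x}|lborel. g t * y t) - (LINT t:{l..x}|lborel. f t)" if x: "l \<le> x" for x
  proof -
    obtain C where C: "\<And>n t. t \<in> {l..x} \<Longrightarrow> \<bar>Y n t\<bar> \<le> C * K t ^ n / fact n"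
      "\<And>n t. t \<in> {l..x} \<Longrightarrow> \<bar>P n t\<bar> \<le> C * K t ^ n / fact n"
      using bounds[of x] by blast
    have nn: "0 \<le> C * K t ^ n / fact n" if "t \<in> {l..x}" for t n
      using C(1)[OF that, of n] by linarith
    have sY: "summable (\<lambda>n. Y n t)" if "t \<in> {l..x}" for t
      by (rule summable_comparison_test'[OF summable_exp_cmult[of C "K t"], where N = 0])
        (simp only: real_norm_def C(1)[OF that])
    have sP: "summable (\<lambda>n. P n t)" if "t \<in> {l..x}" for t
      by (rule summable_comparison_test'[OF summable_exp_cmult[of C "K t"], where N = 0])
        (simp only: real_norm_def C(2)[OF that])
    have bP: "\<bar>P n t\<bar> \<le> k t * (C * K t ^ n / fact n)" if "t \<in> {l..x}" for n t
      using mult_right_mono[OF _ nn[OF that, of n], of 1 "k t"] C(2)[OF that, of n] by (simp add: k_def)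
    have bY: "\<bar>g t * Y n t\<bar> \<le> k t * (C * K t ^ n / fact n)" if "t \<in> {l..x}" for n t
      unfolding abs_mult using C(1)[OF that, of n] by (rule mult_mono[rotated]) (auto simp: k_def)
    have gy: "(\<Sum>n. g t * Y n t) = g t * y t" if "t \<in> {l..x}" for t
      unfolding y_def by (rule suminf_mult[OF sY[OF that]])
    show "set_integrable lborel {l..x} p"
      using swap(1)[OF Pli x bP] by (simp add: p_def)
    have "y x = Y 0 x + (\<Sum>n. Y (Suc n) x)"
      unfolding y_def using suminf_split_head[OF sY[of x]] x by simp
    also have "\<dots> = a + (LINT t:{l..x}|lborel. p t)"
      using swap(2)[OF Pli x bP] by (simp add: Y0 YS p_def)
    finally show "y x = a + (LINT t:{l..x}|lborel. p t)" .
    show "set_integrable lborel {l..x} (\<lambda>t. g t * y t)"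
      using swap(1)[OF gYli x bY] gy by (subst set_integrable_cong[OF refl refl, of _ _ "\<lambda>t. \<Sum>n. g t * Y n t"]) auto
    have "p x = P 0 x + (\<Sum>n. P (Suc n) x)"
      unfolding p_def using suminf_split_head[OF sP[of x]] x by simp
    also have "(\<Sum>n. P (Suc n) x) = (LINT t:{l..x}|lborel. g t * y t)"
      using swap(2)[OF gYli x bY] gy unfolding PS
      by (subst set_lebesgue_integral_cong[where g = "\<lambda>t. \<Sum>n. g t * Y n t"]) auto
    finally show "p x = b + (LINT t:{l..x}|lborel. g t * y t) - (LINT t:{l..x}|lborel. f t)"
      by (simp add: P0)
  qed
  have li: "loc_int l h" if "\<And>x. l \<le> x \<Longrightarrow> set_integrable lborel {l..x} h" for h :: "real \<Rightarrow> real"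
    unfolding loc_int_def
  proof
    fix x show "set_integrable lborel {l..x} h"
      using that by (cases "l \<le> x") auto
  qed
  have yl: "y l = a" "p l = b" using main(2,4)[of l] by simp_all
  have "primitive l y p"
    unfolding primitive_def using li[OF main(1)] main(2) yl by simp
  moreover have "primitive l p (\<lambda>t. g t * y t - f t)"
    unfolding primitive_def
  proof (intro conjI allI impI)
    show gyf: "loc_int l (\<lambda>t. g t * y t - f t)" by (intro loc_int_diff li main(3) f)
    fix x assume x: "l \<le> x"
    show "p x = p l + (LINT t:{l..x}|lborel. g t * y t - f t)"
      using set_integral_diff(2)[OF main(3)[OF x] loc_int_set_integrable[OF f]] main(4)[OF x] yl by simp
  qed
  ultimately show ?thesis using that yl by blast
qed

section \<open>The real maximal domain\<close>

text \<open>Real counterpart of \<open>L2\<close>, as \<open>rip\<close> is of \<open>ip\<close>.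
  Both \<open>q\<close> and the spectral parameter z < 0 are real, so the analysis can be carried
  out on real and imaginary parts.\<close>

definition sq_int :: "real \<Rightarrow> (real \<Rightarrow> real) \<Rightarrow> bool" where
  "sq_int l f \<longleftrightarrow> set_borel_measurable lborel {l..} f \<and> set_integrable lborel {l..} (\<lambda>x. (f x)\<^sup>2)"

definition rip :: "real \<Rightarrow> (real \<Rightarrow> real) \<Rightarrow> (real \<Rightarrow> real) \<Rightarrow> real" where
  "rip l f g = (LINT x:{l..}|lborel. f x * g x)"

lemma set_borel_measurable_mult:
  fixes f g :: "'a \<Rightarrow> real"
  assumes "set_borel_measurable M A f" "set_borel_measurable M A g"
  shows "set_borel_measurable M A (\<lambda>x. f x * g x)"
proof -
  have "(\<lambda>x. (indicator A x *\<^sub>R f x) * (indicator A x *\<^sub>R g x)) \<in> borel_measurable M"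
    using assms unfolding set_borel_measurable_def by (rule borel_measurable_times)
  also have "(\<lambda>x. (indicator A x *\<^sub>R f x) * (indicator A x *\<^sub>R g x)) = (\<lambda>x. indicator A x *\<^sub>R (f x * g x))"
    by (auto simp: indicator_def)
  finally show ?thesis unfolding set_borel_measurable_def .
qed

lemma set_borel_measurable_add:
  fixes f g :: "'a \<Rightarrow> real"
  assumes "set_borel_measurable M A f" "set_borel_measurable M A g"
  shows "set_borel_measurable M A (\<lambda>x. f x + g x)"
  using borel_measurable_add[OF assms[unfolded set_borel_measurable_def]]
  unfolding set_borel_measurable_def by (simp add: distrib_left)

lemma set_borel_measurable_cmult:
  fixes f :: "'a \<Rightarrow> real"
  assumes "set_borel_measurable M A f"
  shows "set_borel_measurable M A (\<lambda>x. c * f x)"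
  using borel_measurable_times[OF borel_measurable_const assms[unfolded set_borel_measurable_def], of c]
  unfolding set_borel_measurable_def by (simp add: mult.left_commute)

lemma sq_int_mult:
  assumes "sq_int l f" "sq_int l g"
  shows "set_integrable lborel {l..} (\<lambda>x. f x * g x)"
proof (rule set_integrable_bound)
  show "set_integrable lborel {l..} (\<lambda>x. (f x)\<^sup>2 + (g x)\<^sup>2)"
    using assms unfolding sq_int_def by (intro set_integral_add) auto
  show "set_borel_measurable lborel {l..} (\<lambda>x. f x * g x)"
    using assms unfolding sq_int_def by (intro set_borel_measurable_mult) auto
  have "\<bar>f x * g x\<bar> \<le> (f x)\<^sup>2 + (g x)\<^sup>2" for x
    using sum_squares_bound[of "\<bar>f x\<bar>" "\<bar>g x\<bar>"] abs_ge_zero[of "f x * g x"]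
    unfolding abs_mult power2_abs by linarith
  then show "AE x in lborel. x \<in> {l..} \<longrightarrow> norm (f x * g x) \<le> norm ((f x)\<^sup>2 + (g x)\<^sup>2)"
    by simp
qed

lemma sq_int_add_cmult:
  assumes f: "sq_int l f" and g: "sq_int l g"
  shows "sq_int l (\<lambda>x. f x + c * g x)"
  unfolding sq_int_def
proof
  show "set_borel_measurable lborel {l..} (\<lambda>x. f x + c * g x)"
    using assms unfolding sq_int_def by (intro set_borel_measurable_add set_borel_measurable_cmult) auto
  have eq: "(\<lambda>x. (f x + c * g x)\<^sup>2) = (\<lambda>x. (f x * f x + (2 * c) * (f x * g x)) + c\<^sup>2 * (g x * g x))"
    by (auto simp: power2_eq_square algebra_simps)
  show "set_integrable lborel {l..} (\<lambda>x. (f x + c * g x)\<^sup>2)"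
    unfolding eq by (intro set_integral_add set_integrable_mult_right sq_int_mult f g)
qed

lemma sq_int_cmult: "sq_int l g \<Longrightarrow> sq_int l (\<lambda>x. c * g x)"
  unfolding sq_int_def
  by (auto intro: set_borel_measurable_cmult simp: power_mult_distrib)

lemma sq_int_cong:
  assumes "\<And>x. l \<le> x \<Longrightarrow> f x = g x"
  shows "sq_int l f \<longleftrightarrow> sq_int l g"
proof -
  have "(\<lambda>x. indicator {l..} x *\<^sub>R f x) = (\<lambda>x. indicator {l..} x *\<^sub>R g x)"
    "(\<lambda>x. indicator {l..} x *\<^sub>R (f x)\<^sup>2) = (\<lambda>x. indicator {l..} x *\<^sub>R (g x)\<^sup>2)"
    using assms by (auto simp: indicator_def)
  then show ?thesis unfolding sq_int_def set_borel_measurable_def set_integrable_def by simp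
qed

lemma rip_commute: "rip l f g = rip l g f"
  by (simp add: rip_def mult.commute)

lemma rip_add_left:
  assumes "sq_int l f" "sq_int l g" "sq_int l h"
  shows "rip l (\<lambda>x. f x + c * g x) h = rip l f h + c * rip l g h"
proof -
  have "rip l (\<lambda>x. f x + c * g x) h = (LINT x:{l..}|lborel. f x * h x + c * (g x * h x))"
    unfolding rip_def by (simp add: algebra_simps)
  also have "\<dots> = rip l f h + c * rip l g h"
    unfolding rip_def using assms by (subst set_integral_add(2)) (auto intro: sq_int_mult)
  finally show ?thesis .
qed

lemma rip_add_right:
  assumes "sq_int l f" "sq_int l g" "sq_int l h"
  shows "rip l h (\<lambda>x. f x + c * g x) = rip l h f + c * rip l h g"
  using rip_add_left[OF assms] by (simp add: rip_commute)

lemma rip_cmult_left: "rip l (\<lambda>x. c * f x) g = c * rip l f g"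
  unfolding rip_def by (simp add: mult.assoc)

lemma rip_self_nonneg: "0 \<le> rip l f f"
  unfolding rip_def set_lebesgue_integral_def by (rule integral_nonneg_AE) auto

lemma rip_Cauchy_Schwarz:
  assumes f: "sq_int l f" and g: "sq_int l g"
  shows "(rip l f g)\<^sup>2 \<le> rip l f f * rip l g g"
proof -
  have expand: "rip l (\<lambda>x. f x + t * g x) (\<lambda>x. f x + t * g x)
      = rip l f f + 2 * t * rip l f g + t\<^sup>2 * rip l g g" for t
    using f g sq_int_add_cmult[OF f g]
    by (simp add: rip_add_left rip_add_right rip_commute[of l g f] power2_eq_square algebra_simps)
  have nn: "0 \<le> rip l f f + 2 * t * rip l f g + t\<^sup>2 * rip l g g" for t
    using rip_self_nonneg[of l "\<lambda>x. f x + t * g x"] unfolding expand .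
  show ?thesis
  proof (cases "rip l g g = 0")
    case True
    have "rip l f g = 0"
    proof (rule ccontr)
      assume ne: "rip l f g \<noteq> 0"
      \<comment> \<open>With \<open>rip l g g = 0\<close> the quadratic in t is affine, and at this
        t it equals -1.\<close>
      show False using nn[of "- (rip l f f + 1) / (2 * rip l f g)"] ne True by (simp add: field_simps)
    qed
    then show ?thesis using True by simp
  next
    case False
    then have pos: "rip l g g > 0" using rip_self_nonneg[of l g] by simp
    have "0 \<le> rip l f f - (rip l f g)\<^sup>2 / rip l g g"
      using nn[of "- rip l f g / rip l g g"] pos
      by (simp add: power2_eq_square field_simps)
    then show ?thesis using pos by (simp add: field_simps)
  qed
qed

lemma set_integrable_continuous_support:
  fixes f :: "real \<Rightarrow> real"
  assumes "continuous_on {l..} f" and "\<And>x. N < x \<Longrightarrow> f x = 0"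
  shows "set_integrable lborel {l..} f"
proof -
  have "(\<lambda>x. indicator {l..} x *\<^sub>R f x) = (\<lambda>x. indicator {l..N} x *\<^sub>R f x)"
    using assms(2) by (auto simp: indicator_def not_le)
  then show ?thesis
    using loc_int_set_integrable[OF loc_int_continuous[OF assms(1)], of N] by (simp add: set_integrable_def)
qed

lemma sq_int_continuous_support:
  assumes "continuous_on {l..} f" and "\<And>x. N < x \<Longrightarrow> f x = 0"
  shows "sq_int l f"
  unfolding sq_int_def
proof
  show "set_borel_measurable lborel {l..} f"
    by (intro loc_int_measurable loc_int_continuous assms)
  show "set_integrable lborel {l..} (\<lambda>x. (f x)\<^sup>2)"
    by (rule set_integrable_continuous_support[where N = N])
      (use assms in \<open>auto intro: continuous_intros\<close>)
qed

lemma set_integral_support: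
  fixes f :: "real \<Rightarrow> real"
  assumes "\<And>x. N < x \<Longrightarrow> f x = 0"
  shows "(LINT x:{l..}|lborel. f x) = (LINT x:{l..N}|lborel. f x)"
proof -
  have "(\<lambda>x. indicator {l..} x *\<^sub>R f x) = (\<lambda>x. indicator {l..N} x *\<^sub>R f x)"
    using assms by (auto simp: indicator_def not_le)
  then show ?thesis by (simp add: set_lebesgue_integral_def)
qed

definition real_lop :: "(real \<Rightarrow> real) \<Rightarrow> (real \<Rightarrow> real) \<Rightarrow> (real \<Rightarrow> real) \<Rightarrow> real \<Rightarrow> real" where
  "real_lop q y w x = - w x + q x * y x"

definition real_dom :: "(real \<Rightarrow> real) \<Rightarrow> real \<Rightarrow> (real \<Rightarrow> real) \<Rightarrow> (real \<Rightarrow> real) \<Rightarrow> (real \<Rightarrow> real) \<Rightarrow> bool" where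
  "real_dom q l y p w \<longleftrightarrow> primitive l y p \<and> primitive l p w \<and> sq_int l y \<and> sq_int l (real_lop q y w)"

lemma real_lop_add_cmult:
  "real_lop q (\<lambda>x. y x + c * z x) (\<lambda>x. w x + c * v x) = (\<lambda>x. real_lop q y w x + c * real_lop q z v x)"
  by (auto simp: real_lop_def algebra_simps)

lemma real_dom_add_cmult:
  assumes "real_dom q l y p w" "real_dom q l z r v"
  shows "real_dom q l (\<lambda>x. y x + c * z x) (\<lambda>x. p x + c * r x) (\<lambda>x. w x + c * v x)"
  using assms unfolding real_dom_def real_lop_add_cmult
  by (auto intro: primitive_add primitive_cmult sq_int_add_cmult)

section \<open>Reduction of the complex notions to real and imaginary parts\<close>

lemma set_integrable_complex_iff:
  fixes f :: "'a \<Rightarrow> complex"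
  shows "set_integrable M A f \<longleftrightarrow>
    set_integrable M A (\<lambda>x. Re (f x)) \<and> set_integrable M A (\<lambda>x. Im (f x))"
proof
  assume "set_integrable M A f"
  then have "integrable M (\<lambda>x. Re (indicator A x *\<^sub>R f x))" "integrable M (\<lambda>x. Im (indicator A x *\<^sub>R f x))"
    unfolding set_integrable_def by (rule integrable_Re integrable_Im)+
  then show "set_integrable M A (\<lambda>x. Re (f x)) \<and> set_integrable M A (\<lambda>x. Im (f x))"
    unfolding set_integrable_def by simp
next
  assume a: "set_integrable M A (\<lambda>x. Re (f x)) \<and> set_integrable M A (\<lambda>x. Im (f x))"
  have "integrable M (\<lambda>x. complex_of_real (indicator A x *\<^sub>R Re (f x)) +
      \<i> * complex_of_real (indicator A x *\<^sub>R Im (f x)))"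
    using a unfolding set_integrable_def
    by (intro Bochner_Integration.integrable_add integrable_mult_right integrable_of_real) auto
  also have "(\<lambda>x. complex_of_real (indicator A x *\<^sub>R Re (f x)) +
      \<i> * complex_of_real (indicator A x *\<^sub>R Im (f x))) = (\<lambda>x. indicator A x *\<^sub>R f x)"
    by (auto simp: complex_eq_iff)
  finally show "set_integrable M A f" unfolding set_integrable_def .
qed

lemma set_integral_Re_Im:
  fixes f :: "'a \<Rightarrow> complex"
  assumes "set_integrable M A f"
  shows "Re (LINT x:A|M. f x) = (LINT x:A|M. Re (f x))" "Im (LINT x:A|M. f x) = (LINT x:A|M. Im (f x))"
  using assms unfolding set_integrable_def set_lebesgue_integral_def
  by (simp_all flip: integral_Re integral_Im)

lemma loc_int_complex_iff:
  "loc_int l f \<longleftrightarrow> loc_int l (\<lambda>x. Re (f x)) \<and> loc_int l (\<lambda>x. Im (f x))"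
  unfolding loc_int_def set_integrable_complex_iff[of _ _ f] by blast

lemma complex_primitive_iff:
  "loc_int l f \<and> (\<forall>x\<ge>l. F x = F l + (LINT t:{l..x}|lborel. f t)) \<longleftrightarrow>
    primitive l (\<lambda>x. Re (F x)) (\<lambda>x. Re (f x)) \<and> primitive l (\<lambda>x. Im (F x)) (\<lambda>x. Im (f x))"
proof (cases "loc_int l f")
  case True
  then show ?thesis
    using loc_int_complex_iff[of l f]
    by (auto simp: primitive_def complex_eq_iff set_integral_Re_Im loc_int_set_integrable)
next
  case False
  then show ?thesis using loc_int_complex_iff[of l f] by (auto simp: primitive_def)
qed

lemma set_borel_measurable_complex_iff:
  fixes f :: "'a \<Rightarrow> complex"
  shows "set_borel_measurable M A f \<longleftrightarrow>
    set_borel_measurable M A (\<lambda>x. Re (f x)) \<and> set_borel_measurable M A (\<lambda>x. Im (f x))"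
  unfolding set_borel_measurable_def borel_measurable_complex_iff[of "\<lambda>x. indicator A x *\<^sub>R f x"]
  by simp

lemma L2_iff: "L2 l f \<longleftrightarrow> sq_int l (\<lambda>x. Re (f x)) \<and> sq_int l (\<lambda>x. Im (f x))"
proof
  assume f: "L2 l f"
  then have m: "set_borel_measurable lborel {l..} (\<lambda>x. Re (f x))" "set_borel_measurable lborel {l..} (\<lambda>x. Im (f x))"
    and i: "set_integrable lborel {l..} (\<lambda>x. (cmod (f x))\<^sup>2)"
    unfolding L2_def set_borel_measurable_complex_iff[of _ _ f] by auto
  have "set_integrable lborel {l..} (\<lambda>x. (Re (f x))\<^sup>2)" "set_integrable lborel {l..} (\<lambda>x. (Im (f x))\<^sup>2)"
    using set_borel_measurable_mult[OF m(1) m(1)] set_borel_measurable_mult[OF m(2) m(2)]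
    by (auto intro!: set_integrable_bound[OF i] simp: power2_eq_square[symmetric] cmod_power2)
  with m show "sq_int l (\<lambda>x. Re (f x)) \<and> sq_int l (\<lambda>x. Im (f x))" by (simp add: sq_int_def)
next
  assume "sq_int l (\<lambda>x. Re (f x)) \<and> sq_int l (\<lambda>x. Im (f x))"
  then show "L2 l f"
    unfolding L2_def sq_int_def set_borel_measurable_complex_iff[of _ _ f] cmod_power2 by simp
qed

lemma Re_Im_lop:
  "Re (lop q y w x) = real_lop q (\<lambda>x. Re (y x)) (\<lambda>x. Re (w x)) x"
  "Im (lop q y w x) = real_lop q (\<lambda>x. Im (y x)) (\<lambda>x. Im (w x)) x"
  by (simp_all add: lop_def real_lop_def)

text \<open>As \<open>q\<close> is real, the differential expression commutes with taking real and
  imaginary parts, so estimates on the maximal domain can be proved for real functions and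
  added.\<close>

lemma dom_max_iff:
  "dom_max q l y p w \<longleftrightarrow>
    real_dom q l (\<lambda>x. Re (y x)) (\<lambda>x. Re (p x)) (\<lambda>x. Re (w x)) \<and>
    real_dom q l (\<lambda>x. Im (y x)) (\<lambda>x. Im (p x)) (\<lambda>x. Im (w x))"
proof -
  have "dom_max q l y p w \<longleftrightarrow> (loc_int l p \<and> (\<forall>x\<ge>l. y x = y l + (LINT t:{l..x}|lborel. p t))) \<and>
     (loc_int l w \<and> (\<forall>x\<ge>l. p x = p l + (LINT t:{l..x}|lborel. w t))) \<and> L2 l y \<and> L2 l (lop q y w)"
    unfolding dom_max_def by blast
  then show ?thesis
    unfolding complex_primitive_iff L2_iff Re_Im_lop real_dom_def by auto
qed

lemma Re_Im_ip:
  assumes "L2 l f" "L2 l g"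
  shows "Re (ip l f g) = rip l (\<lambda>x. Re (f x)) (\<lambda>x. Re (g x)) + rip l (\<lambda>x. Im (f x)) (\<lambda>x. Im (g x))"
    "Im (ip l f g) = rip l (\<lambda>x. Im (f x)) (\<lambda>x. Re (g x)) - rip l (\<lambda>x. Re (f x)) (\<lambda>x. Im (g x))"
proof -
  note s = assms[unfolded L2_iff]
  have i: "set_integrable lborel {l..} (\<lambda>x. Re (f x) * Re (g x))"
    "set_integrable lborel {l..} (\<lambda>x. Re (f x) * Im (g x))"
    "set_integrable lborel {l..} (\<lambda>x. Im (f x) * Re (g x))"
    "set_integrable lborel {l..} (\<lambda>x. Im (f x) * Im (g x))"
    using s by (auto intro: sq_int_mult)
  have fg: "set_integrable lborel {l..} (\<lambda>x. f x * cnj (g x))"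
    unfolding set_integrable_complex_iff[of _ _ "\<lambda>x. f x * cnj (g x)"]
    using set_integral_add(1)[OF i(1,4)] set_integral_diff(1)[OF i(3,2)] by simp
  show "Re (ip l f g) = rip l (\<lambda>x. Re (f x)) (\<lambda>x. Re (g x)) + rip l (\<lambda>x. Im (f x)) (\<lambda>x. Im (g x))"
    unfolding ip_def set_integral_Re_Im(1)[OF fg] rip_def
    using set_integral_add(2)[OF i(1,4)] by simp
  show "Im (ip l f g) = rip l (\<lambda>x. Im (f x)) (\<lambda>x. Re (g x)) - rip l (\<lambda>x. Re (f x)) (\<lambda>x. Im (g x))"
    unfolding ip_def set_integral_Re_Im(2)[OF fg] rip_def
    using set_integral_diff(2)[OF i(3,2)] by simp
qed

section \<open>Compactly supported elements of the domain\<close>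

text \<open>An exponent of at least 2 smooths the corner of \<open>max 0\<close> at the
  origin.\<close>

lemma DERIV_max_power:
  "((\<lambda>u::real. max 0 u ^ Suc (Suc n)) has_real_derivative real (Suc (Suc n)) * max 0 u ^ Suc n) (at u)"
proof (cases u "0 :: real" rule: linorder_cases)
  case less
  have "((\<lambda>u::real. 0) has_real_derivative 0) (at u)" by simp
  then have "((\<lambda>u::real. max 0 u ^ Suc (Suc n)) has_real_derivative 0) (at u)"
    by (rule has_field_derivative_transform_within_open[where S = "{..<0}"]) (use less in auto)
  then show ?thesis using less by simp
next
  case greater
  have "((\<lambda>u::real. u ^ Suc (Suc n)) has_real_derivative real (Suc (Suc n)) * u ^ Suc n) (at u)"
    using DERIV_pow[of "Suc (Suc n)" u] by simp
  then have "((\<lambda>u::real. max 0 u ^ Suc (Suc n)) has_real_derivative real (Suc (Suc n)) * u ^ Suc n) (at u)"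
    by (rule has_field_derivative_transform_within_open[where S = "{0<..}"]) (use greater in auto)
  then show ?thesis using greater by simp
next
  case equal
  have "((\<lambda>y::real. max 0 y ^ Suc n) \<longlongrightarrow> max 0 0 ^ Suc n) (at 0)"
    by (intro tendsto_power tendsto_max tendsto_const tendsto_ident_at)
  then have lim: "((\<lambda>y::real. max 0 y ^ Suc n) \<longlongrightarrow> 0) (at 0)" by simp
  \<comment> \<open>On either side of 0 the difference quotient is again a power of
    \<open>max 0 y\<close>, which tends to 0.\<close>
  have "max 0 y ^ Suc n = (max 0 y ^ Suc (Suc n) - max 0 0 ^ Suc (Suc n)) / (y - 0)"
    if "y \<noteq> 0" for y :: real
    using that by (auto simp: max_def)
  then have "\<forall>\<^sub>F y::real in at 0.
      max 0 y ^ Suc n = (max 0 y ^ Suc (Suc n) - max 0 0 ^ Suc (Suc n)) / (y - 0)"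
    by (intro eventually_mono[OF eventually_neq_at_within[of "0 :: real" 0 UNIV]])
  then have "((\<lambda>y::real. (max 0 y ^ Suc (Suc n) - max 0 0 ^ Suc (Suc n)) / (y - 0)) \<longlongrightarrow> 0) (at 0)"
    by (rule Lim_transform_eventually[OF lim])
  then show ?thesis using equal by (simp add: has_field_derivative_iff)
qed

text \<open>Linear from 1 at \<open>l\<close> to 0 at l + e; it exceeds 1 only to the left of
  \<open>l\<close>. Its cube is the actual cutoff, being the lowest integer power with a continuous
  second derivative.\<close>

definition cutoff :: "real \<Rightarrow> real \<Rightarrow> real \<Rightarrow> real" where
  "cutoff l e x = max 0 (1 - (x - l) / e)"

lemma primitive_cutoff_power:
  assumes e: "0 < e"
  shows "primitive l (\<lambda>x. cutoff l e x ^ Suc (Suc n)) (\<lambda>x. - (real (Suc (Suc n)) / e) * cutoff l e x ^ Suc n)"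
proof (rule primitive_deriv)
  fix x
  have "((\<lambda>x. 1 - (x - l) / e) has_real_derivative - (1 / e)) (at x)"
    using e by (auto intro!: derivative_eq_intros)
  from DERIV_chain2[OF DERIV_max_power this, of n]
  show "((\<lambda>x. cutoff l e x ^ Suc (Suc n)) has_real_derivative
      - (real (Suc (Suc n)) / e) * cutoff l e x ^ Suc n) (at x)"
    unfolding cutoff_def by (simp add: mult.commute)
next
  show "continuous_on {l..} (\<lambda>x. - (real (Suc (Suc n)) / e) * cutoff l e x ^ Suc n)"
    unfolding cutoff_def using e by (intro continuous_intros) auto
qed

lemma continuous_on_cutoff: "0 < e \<Longrightarrow> continuous_on A (cutoff l e)"
  unfolding cutoff_def by (intro continuous_intros) auto

lemma cutoff_left [simp]: "cutoff l e l = 1"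
  by (simp add: cutoff_def)

lemma cutoff_zero: "0 < e \<Longrightarrow> l + e \<le> x \<Longrightarrow> cutoff l e x = 0"
  by (simp add: cutoff_def field_simps)

lemma cutoff_bounds: "0 < e \<Longrightarrow> l \<le> x \<Longrightarrow> 0 \<le> cutoff l e x \<and> cutoff l e x \<le> 1"
  by (simp add: cutoff_def)

text \<open>Multiplying a solution \<open>\<theta>\<close> of \<open>\<theta>'' = q \<theta>\<close> by a cutoff stays in the domain although
  \<open>q\<close> is only locally integrable: in \<open>l(\<theta>\<eta>)\<close> the potential cancels.\<close>

lemma real_dom_cutoff:
  assumes \<theta>: "primitive l \<theta> \<theta>'" "primitive l \<theta>' (\<lambda>x. q x * \<theta> x)" and e: "0 < e"
  obtains v r s where "real_dom q l v r s"
    "\<And>x. v x = \<theta> x * cutoff l e x ^ 3" "v l = \<theta> l" "r l = \<theta>' l - 3 / e * \<theta> l"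
    "\<And>x. real_lop q v s x = 6 / e * \<theta>' x * cutoff l e x ^ 2 - 6 / e\<^sup>2 * \<theta> x * cutoff l e x"
    "\<And>x. l + e \<le> x \<Longrightarrow> v x = 0 \<and> r x = 0 \<and> s x = 0"
proof -
  let ?h = "cutoff l e"
  have \<eta>: "primitive l (\<lambda>x. ?h x ^ 3) (\<lambda>x. - (3 / e) * ?h x ^ 2)"
    using primitive_cutoff_power[OF e, of l 1] by (simp add: numeral_eq_Suc)
  have \<eta>': "primitive l (\<lambda>x. - (3 / e) * ?h x ^ 2) (\<lambda>x. 6 / e\<^sup>2 * ?h x)"
    using primitive_cmult[OF primitive_cutoff_power[OF e, of l 0], of "- (3 / e)"]
    by (simp add: numeral_eq_Suc power2_eq_square)
  define v where "v = (\<lambda>x. \<theta> x * ?h x ^ 3)"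
  define r where "r = (\<lambda>x. \<theta>' x * ?h x ^ 3 + \<theta> x * (- (3 / e) * ?h x ^ 2))"
  define s where "s = (\<lambda>x. (q x * \<theta> x * ?h x ^ 3 + \<theta>' x * (- (3 / e) * ?h x ^ 2))
    + (\<theta>' x * (- (3 / e) * ?h x ^ 2) + \<theta> x * (6 / e\<^sup>2 * ?h x)))"
  have vr: "primitive l v r" unfolding v_def r_def by (rule primitive_mult[OF \<theta>(1) \<eta>])
  have rs: "primitive l r s" unfolding r_def s_def
    by (rule primitive_add[OF primitive_mult[OF \<theta>(2) \<eta>] primitive_mult[OF \<theta>(1) \<eta>']])
  have lop: "real_lop q v s x = 6 / e * \<theta>' x * ?h x ^ 2 - 6 / e\<^sup>2 * \<theta> x * ?h x" for x
    unfolding real_lop_def v_def s_def by (simp add: algebra_simps)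
  have zero: "?h x = 0" if "l + e \<le> x" for x using cutoff_zero[OF e that] .
  have "sq_int l v"
    by (rule sq_int_continuous_support[where N = "l + e"], rule primitive_continuous[OF vr])
      (simp add: v_def zero)
  moreover have "sq_int l (real_lop q v s)"
    unfolding lop
    by (rule sq_int_continuous_support[where N = "l + e"])
      (use e in \<open>auto intro!: continuous_intros primitive_continuous[OF \<theta>(1)]
         primitive_continuous[OF \<theta>(2)] continuous_on_cutoff simp: zero\<close>)
  ultimately have "real_dom q l v r s" using vr rs by (simp add: real_dom_def)
  then show ?thesis
  proof (rule that)
    show "v x = \<theta> x * ?h x ^ 3" for x by (simp add: v_def)
    show "v l = \<theta> l" "r l = \<theta>' l - 3 / e * \<theta> l" by (simp_all add: v_def r_def)
    show "v x = 0 \<and> r x = 0 \<and> s x = 0" if "l + e \<le> x" for x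
      by (simp add: v_def r_def s_def zero[OF that])
  qed (rule lop)
qed

text \<open>Subtracting such a function removes prescribed data at \<open>l\<close> without changing
  anything near infinity.\<close>

lemma real_dom_compact_support:
  assumes q: "loc_int l q"
  obtains v r s N where "real_dom q l v r s" "v l = a" "r l = b" "l \<le> N"
    "\<And>x. N \<le> x \<Longrightarrow> v x = 0 \<and> r x = 0 \<and> s x = 0"
proof -
  have "loc_int l (\<lambda>x. 0 :: real)" by (intro loc_int_continuous continuous_on_const)
  \<comment> \<open>For e = 1 the cubed cutoff has slope -3 at \<open>l\<close>, which costs 3 a;
    the initial slope b + 3 a compensates.\<close>
  then obtain \<theta> \<theta>' where \<theta>: "\<theta> l = a" "\<theta>' l = b + 3 * a" "primitive l \<theta> \<theta>'"
      "primitive l \<theta>' (\<lambda>x. q x * \<theta> x)"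
    using linear_ode_exists[OF q, of "\<lambda>x. 0" a "b + 3 * a"] by auto
  show ?thesis
  proof (rule real_dom_cutoff[OF \<theta>(3,4) zero_less_one])
    fix v r s
    assume v: "real_dom q l v r s" "v l = \<theta> l" "r l = \<theta>' l - 3 / 1 * \<theta> l"
      "\<And>x. l + 1 \<le> x \<Longrightarrow> v x = 0 \<and> r x = 0 \<and> s x = 0"
    show thesis
      by (rule that[OF v(1) _ _ _ v(4)]) (use v(2,3) \<theta>(1,2) in simp_all)
  qed
qed

lemma set_integral_le_const:
  fixes f :: "real \<Rightarrow> real"
  assumes "set_integrable lborel {a..b} f" "a \<le> b" "\<And>x. x \<in> {a..b} \<Longrightarrow> f x \<le> B"
  shows "(LINT x:{a..b}|lborel. f x) \<le> B * (b - a)"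
proof -
  have "set_integrable lborel {a..b} (\<lambda>x. B)"
    by (intro loc_int_set_integrable loc_int_continuous continuous_on_const)
  then have "(LINT x:{a..b}|lborel. f x) \<le> (LINT x:{a..b}|lborel. B)"
    by (intro set_integral_mono assms)
  also have "\<dots> = B * (b - a)" using assms(2) by (simp add: set_lebesgue_integral_def)
  finally show ?thesis .
qed

text \<open>A solution with value 0 and slope 1 at \<open>l\<close> is O(e) on [l, l + e], so after
  the cutoff \<open>v\<close> is O(e) and l(v) is O(1/e). On an interval of length e both the energy
  and the squared norm are O(e).\<close>

lemma real_dom_small_bump:
  assumes q: "loc_int l q" and \<epsilon>: "0 < \<epsilon>"
  obtains v r s where "real_dom q l v r s" "v l = 0" "r l = 1"
    "rip l v v < \<epsilon>" "rip l (real_lop q v s) v < \<epsilon>"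
proof -
  have "loc_int l (\<lambda>x. 0 :: real)" by (intro loc_int_continuous continuous_on_const)
  then obtain \<theta> \<theta>' where \<theta>: "\<theta> l = 0" "\<theta>' l = 1" "primitive l \<theta> \<theta>'"
      "primitive l \<theta>' (\<lambda>x. q x * \<theta> x)"
    using linear_ode_exists[OF q, of "\<lambda>x. 0" 0 1] by auto
  note c\<theta> = primitive_continuous[OF \<theta>(3)] and c\<theta>' = primitive_continuous[OF \<theta>(4)]
  obtain C where C: "\<And>x. x \<in> {l..l + 1} \<Longrightarrow> \<bar>\<theta>' x\<bar> \<le> C"
    using continuous_on_Icc_bounded[OF c\<theta>'] by metis
  have C0: "0 \<le> C" using C[of l] by auto
  have \<theta>C: "\<bar>\<theta> x\<bar> \<le> C * (x - l)" if "x \<in> {l..l + 1}" for x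
  proof -
    have i: "set_integrable lborel {l..x} \<theta>'" by (intro loc_int_set_integrable loc_int_continuous c\<theta>')
    have "\<bar>\<theta> x\<bar> = \<bar>LINT t:{l..x}|lborel. \<theta>' t\<bar>"
      using primitive_integral[OF \<theta>(3), of x] that by (simp add: \<theta>(1))
    also have "\<dots> \<le> (LINT t:{l..x}|lborel. \<bar>\<theta>' t\<bar>)"
      using set_integral_norm_bound[OF i] by simp
    also have "\<dots> \<le> C * (x - l)"
      by (rule set_integral_le_const) (use that C in \<open>auto intro!: set_integrable_abs i\<close>)
    finally show ?thesis .
  qed
  \<comment> \<open>12 C^2 e bounds the energy: 12 C / e for l(v), C e for \<open>v\<close>, and the
    length e. The added 1 makes the inequality strict and the denominator positive also for C =
    0.\<close>
  define e where "e = min 1 (\<epsilon> / (12 * C\<^sup>2 + 1))"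
  have Cp: "0 < 12 * C\<^sup>2 + 1" by (simp add: add_nonneg_pos)
  have e: "0 < e" "e \<le> 1" using \<epsilon> Cp by (auto simp: e_def)
  have "e \<le> \<epsilon> / (12 * C\<^sup>2 + 1)" by (simp add: e_def)
  then have "e * (12 * C\<^sup>2 + 1) \<le> \<epsilon>" by (simp only: pos_le_divide_eq[OF Cp])
  then have small: "12 * C\<^sup>2 * e < \<epsilon>" using e by (simp add: algebra_simps)
  obtain v r s where v: "real_dom q l v r s"
    "\<And>x. v x = \<theta> x * cutoff l e x ^ 3" "v l = \<theta> l" "r l = \<theta>' l - 3 / e * \<theta> l"
    "\<And>x. real_lop q v s x = 6 / e * \<theta>' x * cutoff l e x ^ 2 - 6 / e\<^sup>2 * \<theta> x * cutoff l e x"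
    "\<And>x. l + e \<le> x \<Longrightarrow> v x = 0 \<and> r x = 0 \<and> s x = 0"
    by (rule real_dom_cutoff[OF \<theta>(3,4) e(1)]) blast
  have cv: "continuous_on {l..} v" using v(1) by (auto simp: real_dom_def intro: primitive_continuous)
  have cL: "continuous_on {l..} (real_lop q v s)"
    unfolding v(5) by (intro continuous_intros c\<theta> c\<theta>' continuous_on_cutoff e) (use e in auto)
  have bv: "\<bar>v x\<bar> \<le> C * e" and bL: "\<bar>real_lop q v s x\<bar> \<le> 12 * C / e" if x: "x \<in> {l..l + e}" for x
  proof -
    have h: "0 \<le> cutoff l e x" "cutoff l e x \<le> 1" using cutoff_bounds[OF e(1), of l x] x by auto
    have t: "\<bar>\<theta> x\<bar> \<le> C * e"
      using \<theta>C[of x] x e C0 mult_left_mono[of "x - l" e C] by auto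
    have t': "\<bar>\<theta>' x\<bar> \<le> C" using C[of x] x e by auto
    have p: "cutoff l e x ^ n \<le> 1" "0 \<le> cutoff l e x ^ n" for n using h by (auto intro: power_le_one)
    show "\<bar>v x\<bar> \<le> C * e"
      unfolding v(2) abs_mult using mult_mono[OF t p(1)[of 3]] p(2)[of 3] C0 e by simp
    have "\<bar>6 / e * \<theta>' x * cutoff l e x ^ 2\<bar> \<le> 6 / e * C * 1"
      unfolding abs_mult using t' p[of 2] C0 e by (intro mult_mono) auto
    moreover have "\<bar>6 / e\<^sup>2 * \<theta> x * cutoff l e x\<bar> \<le> 6 / e\<^sup>2 * (C * e) * 1"
      unfolding abs_mult using t h C0 e by (intro mult_mono) auto
    moreover have "6 / e\<^sup>2 * (C * e) * 1 = 6 / e * C" using e by (simp add: power2_eq_square)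
    moreover have "12 * C / e = 6 / e * C + 6 / e * C" by simp
    ultimately show "\<bar>real_lop q v s x\<bar> \<le> 12 * C / e"
      unfolding v(5) by linarith
  qed
  have "rip l v v = (LINT x:{l..l + e}|lborel. v x * v x)"
    unfolding rip_def by (rule set_integral_support) (use v(6) in auto)
  also have "\<dots> \<le> (C * e * (C * e)) * ((l + e) - l)"
  proof (rule set_integral_le_const)
    show "set_integrable lborel {l..l + e} (\<lambda>x. v x * v x)"
      by (intro loc_int_set_integrable loc_int_continuous continuous_intros cv)
    show "v x * v x \<le> C * e * (C * e)" if "x \<in> {l..l + e}" for x
      using mult_mono[OF bv[OF that] bv[OF that]] C0 e by (simp flip: abs_mult)
  qed (use e in simp)
  also have "\<dots> = C\<^sup>2 * e * (e * e)" by (simp add: power2_eq_square)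
  also have "\<dots> \<le> C\<^sup>2 * e * 1" using e by (intro mult_left_mono) (auto intro: mult_le_one)
  also have "\<dots> \<le> 12 * C\<^sup>2 * e" using e by simp
  finally have 1: "rip l v v < \<epsilon>" using small by simp
  have "rip l (real_lop q v s) v = (LINT x:{l..l + e}|lborel. real_lop q v s x * v x)"
    unfolding rip_def by (rule set_integral_support) (use v(6) in auto)
  also have "\<dots> \<le> (12 * C / e * (C * e)) * ((l + e) - l)"
  proof (rule set_integral_le_const)
    show "set_integrable lborel {l..l + e} (\<lambda>x. real_lop q v s x * v x)"
      by (intro loc_int_set_integrable loc_int_continuous continuous_intros cv cL)
    show "real_lop q v s x * v x \<le> 12 * C / e * (C * e)" if "x \<in> {l..l + e}" for x
    proof -
      have "real_lop q v s x * v x \<le> \<bar>real_lop q v s x\<bar> * \<bar>v x\<bar>" by (simp flip: abs_mult)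
      also have "\<dots> \<le> 12 * C / e * (C * e)"
        using C0 e by (intro mult_mono bL bv that) auto
      finally show ?thesis .
    qed
  qed (use e in simp)
  also have "\<dots> = 12 * C\<^sup>2 * e" using e by (simp add: power2_eq_square)
  finally have 2: "rip l (real_lop q v s) v < \<epsilon>" using small by simp
  show ?thesis using that[OF v(1)] v(3,4) \<theta>(1,2) 1 2 by simp
qed

section \<open>Green's formula and the Dirichlet extension\<close>

text \<open>The potential terms cancel, and what remains of the integrand is the derivative of y z'
  - y' z.\<close>

lemma lagrange_identity:
  assumes y: "primitive l y p" "primitive l p w" and z: "primitive l z r" "primitive l r v"
    and N: "l \<le> N"
  shows "(LINT x:{l..N}|lborel. real_lop q y w x * z x - y x * real_lop q z v x) =
    (p l * z l - y l * r l) - (p N * z N - y N * r N)"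
proof -
  note W = primitive_add[OF primitive_mult[OF y(1) z(2)] primitive_cmult[OF primitive_mult[OF y(2) z(1)], of "- 1"]]
  have "(LINT x:{l..N}|lborel. real_lop q y w x * z x - y x * real_lop q z v x)
      = (LINT x:{l..N}|lborel. (p x * r x + y x * v x) + - 1 * (w x * z x + p x * r x))"
    by (simp add: real_lop_def algebra_simps)
  also have "\<dots> = (p l * z l - y l * r l) - (p N * z N - y N * r N)"
    using primitive_integral[OF W N] by simp
  finally show ?thesis .
qed

lemma green_compact_support:
  assumes y: "real_dom q l y p w" and z: "real_dom q l z r v" and N: "l \<le> N"
    and zero: "\<And>x. N \<le> x \<Longrightarrow> z x = 0 \<and> r x = 0 \<and> v x = 0"
  shows "rip l (real_lop q y w) z - rip l y (real_lop q z v) = p l * z l - y l * r l"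
proof -
  have i: "set_integrable lborel {l..} (\<lambda>x. real_lop q y w x * z x)"
    "set_integrable lborel {l..} (\<lambda>x. y x * real_lop q z v x)"
    using y z by (auto simp: real_dom_def intro: sq_int_mult)
  have "rip l (real_lop q y w) z - rip l y (real_lop q z v)
      = (LINT x:{l..}|lborel. real_lop q y w x * z x - y x * real_lop q z v x)"
    unfolding rip_def by (rule set_integral_diff(2)[OF i, symmetric])
  also have "\<dots> = (LINT x:{l..N}|lborel. real_lop q y w x * z x - y x * real_lop q z v x)"
    by (rule set_integral_support) (use zero in \<open>simp add: real_lop_def\<close>)
  also have "\<dots> = p l * z l - y l * r l"
    using lagrange_identity[of l y p w z r v N q] y z N zero[of N] by (simp add: real_dom_def)
  finally show ?thesis .
qed

section \<open>Solutions for a real spectral parameter\<close>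

definition real_sol :: "(real \<Rightarrow> real) \<Rightarrow> real \<Rightarrow> real \<Rightarrow> (real \<Rightarrow> real) \<Rightarrow> (real \<Rightarrow> real) \<Rightarrow> bool" where
  "real_sol q l z y p \<longleftrightarrow> primitive l y p \<and> primitive l p (\<lambda>x. (q x - z) * y x)"

lemma real_lop_sol: "real_lop q y (\<lambda>x. (q x - z) * y x) = (\<lambda>x. z * y x)"
  by (auto simp: real_lop_def algebra_simps)

lemma real_sol_exists:
  assumes "loc_int l q"
  obtains y p where "real_sol q l z y p" "y l = a" "p l = b"
proof -
  have "loc_int l (\<lambda>x. q x - z)" "loc_int l (\<lambda>x. 0 :: real)"
    by (intro loc_int_diff assms loc_int_continuous continuous_on_const)+
  then obtain y p where "y l = a" "p l = b" "primitive l y p" "primitive l p (\<lambda>t. (q t - z) * y t - 0)"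
    by (rule linear_ode_exists)
  then show ?thesis using that by (simp add: real_sol_def)
qed

lemma real_sol_add_cmult:
  assumes "real_sol q l z y p" "real_sol q l z u r"
  shows "real_sol q l z (\<lambda>x. y x + c * u x) (\<lambda>x. p x + c * r x)"
proof -
  have "(\<lambda>x. (q x - z) * (y x + c * u x)) = (\<lambda>x. (q x - z) * y x + c * ((q x - z) * u x))"
    by (auto simp: algebra_simps)
  then show ?thesis
    using assms unfolding real_sol_def by (auto intro: primitive_add primitive_cmult)
qed

lemma wronskian_const:
  assumes "real_sol q l z y p" "real_sol q l z u r" "l \<le> x"
  shows "p x * u x - y x * r x = p l * u l - y l * r l"
  using lagrange_identity[where q = q and N = x] assms unfolding real_sol_def
  by (fastforce simp: real_lop_sol)

text \<open>The difference of the solutions has Wronskian 0 with each member of the pair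
  \<open>f\<close>, \<open>g\<close>. That pair has Wronskian -1 at every point, so the difference
  vanishes.\<close>

lemma real_sol_unique:
  assumes q: "loc_int l q" and y: "real_sol q l z y p" and u: "real_sol q l z u r"
    and "y l = u l" "p l = r l" and x: "l \<le> x"
  shows "y x = u x"
proof -
  obtain f f' where f: "real_sol q l z f f'" "f l = 0" "f' l = 1" by (rule real_sol_exists[OF q])
  obtain g g' where g: "real_sol q l z g g'" "g l = -1" "g' l = 0" by (rule real_sol_exists[OF q])
  define d where "d = y x + (-1) * u x"
  define d' where "d' = p x + (-1) * r x"
  note D = real_sol_add_cmult[OF y u, of "-1"]
  have 1: "d' * f x = d * f' x" and 2: "d' * g x = d * g' x" and 3: "f' x * g x - f x * g' x = - 1"
    using wronskian_const[OF D f(1) x] wronskian_const[OF D g(1) x] wronskian_const[OF f(1) g(1) x] assms f g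
    by (simp_all add: d_def d'_def)
  have "d = - (d * (f' x * g x - f x * g' x))" by (simp add: 3)
  also have "\<dots> = - ((d * f' x) * g x - f x * (d * g' x))" by (simp add: algebra_simps)
  also have "\<dots> = 0" by (simp flip: 1 2)
  finally show ?thesis by (simp add: d_def)
qed

lemma real_dom_sol:
  "real_sol q l z y p \<Longrightarrow> sq_int l y \<Longrightarrow> real_dom q l y p (\<lambda>x. (q x - z) * y x)"
  by (simp add: real_sol_def real_dom_def real_lop_sol sq_int_cmult)

section \<open>Symmetry of the minimal operator and the bound for the Dirichlet extension\<close>

locale nonneg_schrodinger =
  fixes q :: "real \<Rightarrow> real" and l :: real
  assumes q: "loc_int l q" and nonneg: "nonneg_min q l"
begin

text \<open>Both claims come from the complex hypothesis at the single function y + i z: the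
  vanishing imaginary part of its form is the symmetry relation, the real part is the sum of the two
  forms.\<close>

lemma min_form:
  assumes y: "real_dom q l y p w" and z: "real_dom q l z r v"
    and "y l = 0" "p l = 0" "z l = 0" "r l = 0"
  shows "rip l (real_lop q y w) z = rip l y (real_lop q z v)"
    "0 \<le> rip l (real_lop q y w) y + rip l (real_lop q z v) z"
proof -
  let ?y = "\<lambda>x. Complex (y x) (z x)" and ?p = "\<lambda>x. Complex (p x) (r x)" and ?w = "\<lambda>x. Complex (w x) (v x)"
  have d: "dom_max q l ?y ?p ?w" using y z by (simp add: dom_max_iff)
  then have L: "L2 l (lop q ?y ?w)" "L2 l ?y" by (auto simp: dom_max_def)
  have "Im (ip l (lop q ?y ?w) ?y) = 0 \<and> 0 \<le> Re (ip l (lop q ?y ?w) ?y)"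
  proof (rule nonneg[unfolded nonneg_min_def, rule_format], intro conjI)
    show "Complex (y l) (z l) = 0" "Complex (p l) (r l) = 0" using assms(3-) by (simp_all add: complex_eq_iff)
  qed (rule d)
  then show "rip l (real_lop q y w) z = rip l y (real_lop q z v)"
    "0 \<le> rip l (real_lop q y w) y + rip l (real_lop q z v) z"
    unfolding Re_Im_ip[OF L] Re_Im_lop by (simp_all add: rip_commute)
qed

text \<open>Symmetry of the minimal operator makes the boundary terms at infinity vanish.\<close>

lemma green:
  assumes y: "real_dom q l y p w" and z: "real_dom q l z r v"
  shows "rip l (real_lop q y w) z - rip l y (real_lop q z v) = p l * z l - y l * r l"
proof -
  \<comment> \<open>Once compactly supported functions with the same data at \<open>l\<close> are
    subtracted, the differences lie in the minimal domain, and every pairing with a subtracted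
    function obeys Green's formula on a finite interval.\<close>
  obtain y1 p1 w1 M where y1: "real_dom q l y1 p1 w1" "y1 l = y l" "p1 l = p l" "l \<le> M"
    "\<And>x. M \<le> x \<Longrightarrow> y1 x = 0 \<and> p1 x = 0 \<and> w1 x = 0" by (rule real_dom_compact_support[OF q]) blast
  obtain z1 r1 v1 N where z1: "real_dom q l z1 r1 v1" "z1 l = z l" "r1 l = r l" "l \<le> N"
    "\<And>x. N \<le> x \<Longrightarrow> z1 x = 0 \<and> r1 x = 0 \<and> v1 x = 0" by (rule real_dom_compact_support[OF q]) blast
  have s: "sq_int l y" "sq_int l y1" "sq_int l z" "sq_int l z1"
    "sq_int l (real_lop q y w)" "sq_int l (real_lop q y1 w1)"
    "sq_int l (real_lop q z v)" "sq_int l (real_lop q z1 v1)"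
    using y z y1(1) z1(1) by (auto simp: real_dom_def)
  have "rip l (real_lop q (\<lambda>x. y x + - 1 * y1 x) (\<lambda>x. w x + - 1 * w1 x)) (\<lambda>x. z x + - 1 * z1 x) =
     rip l (\<lambda>x. y x + - 1 * y1 x) (real_lop q (\<lambda>x. z x + - 1 * z1 x) (\<lambda>x. v x + - 1 * v1 x))"
    by (rule min_form(1)[OF real_dom_add_cmult[OF y y1(1), of "-1"] real_dom_add_cmult[OF z z1(1), of "-1"]])
      (use y1(2,3) z1(2,3) in simp_all)
  then have e: "rip l (real_lop q y w) z - rip l (real_lop q y1 w1) z
      - rip l (real_lop q y w) z1 + rip l (real_lop q y1 w1) z1 =
    rip l y (real_lop q z v) - rip l y1 (real_lop q z v)
      - rip l y (real_lop q z1 v1) + rip l y1 (real_lop q z1 v1)"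
    unfolding real_lop_add_cmult
    by (simp only: rip_add_left rip_add_right s sq_int_add_cmult) simp
  show ?thesis
    using green_compact_support[OF y z1(1,4,5)] green_compact_support[OF y1(1) z1(1,4,5)]
      green_compact_support[OF z y1(1,4,5)] e y1(2,3) z1(2,3)
    by (simp add: rip_commute[of l z] rip_commute[of l "real_lop q z v"] algebra_simps)
qed

text \<open>The Dirichlet extension has the same lower bound: it is the Friedrichs extension, because
  bumps with slope 1 at the endpoint can have arbitrarily small energy.\<close>

lemma dirichlet_nonneg:
  assumes g: "real_dom q l g p w" and g0: "g l = 0"
  shows "0 \<le> rip l (real_lop q g w) g"
proof (rule ccontr)
  define \<delta> where "\<delta> = - rip l (real_lop q g w) g"
  define b where "b = p l"
  define G where "G = rip l (real_lop q g w) (real_lop q g w)"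
  \<comment> \<open>\<open>K\<close> collects the coefficients of \<epsilon> in the final estimate;
    the choice of \<epsilon> below makes K \<epsilon> smaller than \<delta> / 2.\<close>
  define K where "K = 2 * b\<^sup>2 * G / \<delta> + b\<^sup>2"
  assume "\<not> 0 \<le> rip l (real_lop q g w) g"
  then have \<delta>: "0 < \<delta>" by (simp add: \<delta>_def)
  have G: "0 \<le> G" by (simp add: G_def rip_self_nonneg)
  have K: "0 \<le> K" using \<delta> G by (simp add: K_def)
  define \<epsilon> where "\<epsilon> = \<delta> / (2 * (K + 1))"
  have \<epsilon>: "0 < \<epsilon>" using \<delta> K by (simp add: \<epsilon>_def)
  have "K * \<epsilon> < (K + 1) * \<epsilon>" using \<epsilon> by simp
  also have "\<dots> = \<delta> / 2" using K by (simp add: \<epsilon>_def field_simps)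
  finally have K\<epsilon>: "K * \<epsilon> < \<delta> / 2" .
  obtain v r s where v: "real_dom q l v r s" "v l = 0" "r l = 1" "rip l v v < \<epsilon>" "rip l (real_lop q v s) v < \<epsilon>"
    by (rule real_dom_small_bump[OF q \<epsilon>])
  define X where "X = rip l (real_lop q g w) v"
  have s: "sq_int l g" "sq_int l v" "sq_int l (real_lop q g w)" "sq_int l (real_lop q v s)"
    using g v(1) by (auto simp: real_dom_def)
  have sym: "rip l (real_lop q v s) g = X"
    using green[OF v(1) g] v(2,3) g0 by (simp add: X_def rip_commute)
  \<comment> \<open>Removing b times the bump, b being the slope of \<open>g\<close> at
    \<open>l\<close>, moves \<open>g\<close> into the minimal domain.\<close>
  have "0 \<le> rip l (real_lop q (\<lambda>x. g x + - b * v x) (\<lambda>x. w x + - b * s x)) (\<lambda>x. g x + - b * v x)"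
    using min_form(2)[OF real_dom_add_cmult[OF g v(1), of "- b"] real_dom_add_cmult[OF g v(1), of "- b"]]
      g0 v(2,3) by (simp add: b_def)
  also have "\<dots> = - \<delta> - 2 * b * X + b\<^sup>2 * rip l (real_lop q v s) v"
    unfolding real_lop_add_cmult
    by (simp only: rip_add_left rip_add_right s sq_int_add_cmult sym)
      (simp add: X_def \<delta>_def power2_eq_square algebra_simps)
  finally have 1: "0 \<le> - \<delta> - 2 * b * X + b\<^sup>2 * rip l (real_lop q v s) v" .
  have X2: "X\<^sup>2 \<le> G * \<epsilon>"
    using rip_Cauchy_Schwarz[OF s(3,2)] mult_left_mono[OF less_imp_le[OF v(4)] G]
    by (simp add: X_def G_def)
  \<comment> \<open>The cross term is absorbed at the cost of half of \<delta>; the rest is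
    quadratic in \<open>X\<close>, hence O(\<epsilon>).\<close>
  have "0 \<le> (\<delta> + 2 * b * X)\<^sup>2 / (2 * \<delta>)" using \<delta> by simp
  also have "\<dots> = \<delta> / 2 + 2 * b * X + 2 * b\<^sup>2 * X\<^sup>2 / \<delta>"
    using \<delta> by (simp add: power2_eq_square field_simps)
  finally have "- (2 * b * X) \<le> \<delta> / 2 + 2 * b\<^sup>2 * X\<^sup>2 / \<delta>" by linarith
  moreover have "2 * b\<^sup>2 * X\<^sup>2 / \<delta> \<le> 2 * b\<^sup>2 * (G * \<epsilon>) / \<delta>"
    using X2 \<delta> by (intro divide_right_mono mult_left_mono) auto
  moreover have "b\<^sup>2 * rip l (real_lop q v s) v \<le> b\<^sup>2 * \<epsilon>"
    using v(5) by (intro mult_left_mono) auto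
  moreover have "K * \<epsilon> = 2 * b\<^sup>2 * (G * \<epsilon>) / \<delta> + b\<^sup>2 * \<epsilon>"
    by (simp add: K_def algebra_simps)
  ultimately show False using 1 K\<epsilon> by linarith
qed

text \<open>A function of norm 0 is orthogonal to everything, so the boundary term in Green's
  formula vanishes against arbitrary data (a, b).\<close>

lemma sol_norm_zero:
  assumes u: "real_sol q l z u p" "sq_int l u" and zero: "rip l u u = 0"
  shows "u l = 0 \<and> p l = 0"
proof -
  have r0: "rip l u f = 0" if "sq_int l f" for f
    using rip_Cauchy_Schwarz[OF u(2) that] zero by simp
  have "p l * a - u l * b = 0" for a b
  proof -
    obtain v r s N where v: "real_dom q l v r s" "v l = a" "r l = b"
      by (rule real_dom_compact_support[OF q]) blast
    have s: "sq_int l v" "sq_int l (real_lop q v s)" using v(1) by (auto simp: real_dom_def)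
    show ?thesis
      using green[OF real_dom_sol[OF u] v(1)] r0[OF s(1)] r0[OF s(2)] v(2,3)
      by (simp add: real_lop_sol rip_cmult_left)
  qed
  from this[of 1 0] this[of 0 1] show ?thesis by simp
qed

text \<open>The Dirichlet form of \<open>u\<close> is z times its squared norm, so that norm is 0.
  Hence for z < 0 the solution with data (0, 1) is not square integrable, which both the existence
  and the uniqueness of the Weyl coefficient rely on.\<close>

lemma no_negative_dirichlet_eigenvalue:
  assumes u: "real_sol q l z u p" "sq_int l u" and "u l = 0" "z < 0"
  shows "p l = 0"
proof -
  have "0 \<le> z * rip l u u"
    using dirichlet_nonneg[OF real_dom_sol[OF u]] assms(3) by (simp add: real_lop_sol rip_cmult_left)
  then have "rip l u u = 0" using \<open>z < 0\<close> rip_self_nonneg[of l u] by (simp add: zero_le_mult_iff)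
  then show ?thesis using sol_norm_zero[OF u] by simp
qed

end

section \<open>Weyl solutions below the spectrum\<close>

text \<open>Monotone convergence along the intervals [l, l + n].\<close>

lemma sq_int_of_bounded:
  assumes f: "continuous_on {l..} f" and K: "\<And>n::nat. (LINT x:{l..l + real n}|lborel. (f x)\<^sup>2) \<le> K"
  shows "sq_int l f"
  unfolding sq_int_def
proof
  show "set_borel_measurable lborel {l..} f" by (intro loc_int_measurable loc_int_continuous f)
  have c2: "loc_int l (\<lambda>x. (f x)\<^sup>2)" by (intro loc_int_continuous continuous_intros f)
  let ?F = "\<lambda>n x. indicator {l..l + real n} x *\<^sub>R (f x)\<^sup>2"
  have i: "integrable lborel (?F n)" for n
    using loc_int_set_integrable[OF c2] unfolding set_integrable_def .
  have mono: "?F m x \<le> ?F n x" if "m \<le> n" for m n :: nat and x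
    using that by (auto simp: indicator_def)
  have "incseq (\<lambda>n. \<integral>x. ?F n x \<partial>lborel)"
    unfolding incseq_def by (intro allI impI integral_mono i mono)
  then obtain L where L: "(\<lambda>n. \<integral>x. ?F n x \<partial>lborel) \<longlonglongrightarrow> L"
    by (rule incseq_convergent) (use K in \<open>auto simp: set_lebesgue_integral_def\<close>)
  show "set_integrable lborel {l..} (\<lambda>x. (f x)\<^sup>2)"
    unfolding set_integrable_def
  proof (rule integrable_monotone_convergence[OF i _ _ L])
    show "AE x in lborel. mono (\<lambda>n. ?F n x)" using mono by (auto simp: mono_def)
    have "(\<lambda>n. ?F n x) \<longlonglongrightarrow> indicator {l..} x *\<^sub>R (f x)\<^sup>2" for x
    proof (rule tendsto_eventually)
      obtain N :: nat where N: "x - l \<le> N" using real_arch_simple by blast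
      show "\<forall>\<^sub>F n in sequentially. ?F n x = indicator {l..} x *\<^sub>R (f x)\<^sup>2"
        using eventually_ge_at_top[of N]
      proof eventually_elim
        fix n assume "N \<le> n"
        with N have "x \<le> l + real n" by linarith
        then show "?F n x = indicator {l..} x *\<^sub>R (f x)\<^sup>2" by (auto simp: indicator_def)
      qed
    qed
    then show "AE x in lborel. (\<lambda>n. ?F n x) \<longlonglongrightarrow> indicator {l..} x *\<^sub>R (f x)\<^sup>2" by simp
    show "(\<lambda>x. indicator {l..} x *\<^sub>R (f x)\<^sup>2) \<in> borel_measurable lborel"
      using loc_int_measurable[OF c2] unfolding set_borel_measurable_def .
  qed
qed

text \<open>Turns integrals over [l, N] into values of \<open>rip\<close>, so that Cauchy-Schwarz
  applies to them.\<close>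

definition trunc :: "real \<Rightarrow> (real \<Rightarrow> real) \<Rightarrow> real \<Rightarrow> real" where
  "trunc N f x = (if x \<le> N then f x else 0)"

lemma set_integral_trunc:
  assumes "N \<le> M"
  shows "(LINT x:{l..M}|lborel. trunc N f x * g x) = (LINT x:{l..N}|lborel. f x * g x)"
proof -
  have "(\<lambda>x. indicator {l..M} x *\<^sub>R (trunc N f x * g x)) = (\<lambda>x. indicator {l..N} x *\<^sub>R (f x * g x))"
    using assms by (auto simp: indicator_def trunc_def)
  then show ?thesis by (simp add: set_lebesgue_integral_def)
qed

lemma rip_trunc: "rip l (trunc N f) g = (LINT x:{l..N}|lborel. f x * g x)"
proof -
  have "(\<lambda>x. indicator {l..} x *\<^sub>R (trunc N f x * g x)) = (\<lambda>x. indicator {l..N} x *\<^sub>R (f x * g x))"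
    by (auto simp: indicator_def trunc_def)
  then show ?thesis by (simp add: rip_def set_lebesgue_integral_def)
qed

lemma rip_trunc_trunc: "rip l (trunc N f) (trunc N g) = rip l (trunc N f) g"
  unfolding rip_trunc by (rule set_lebesgue_integral_cong) (auto simp: trunc_def)

lemma loc_int_trunc:
  assumes "continuous_on {l..} f"
  shows "loc_int l (trunc N f)"
  unfolding loc_int_def
proof
  fix b
  have "(\<lambda>x. indicator {l..b} x *\<^sub>R trunc N f x) = (\<lambda>x. indicator {l..min b N} x *\<^sub>R f x)"
    by (auto simp: indicator_def trunc_def)
  then show "set_integrable lborel {l..b} (trunc N f)"
    using loc_int_set_integrable[OF loc_int_continuous[OF assms], of "min b N"]
    by (simp add: set_integrable_def)
qed

lemma sq_int_trunc:
  assumes "continuous_on {l..} f"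
  shows "sq_int l (trunc N f)"
  unfolding sq_int_def
proof
  show "set_borel_measurable lborel {l..} (trunc N f)"
    by (intro loc_int_measurable loc_int_trunc assms)
  have "continuous_on {l..} (\<lambda>x. (f x)\<^sup>2)" by (intro continuous_intros assms)
  from loc_int_set_integrable[OF loc_int_continuous[OF this], of N]
  have "integrable lborel (\<lambda>x. indicator {l..N} x *\<^sub>R (f x)\<^sup>2)" unfolding set_integrable_def .
  moreover have "(\<lambda>x. indicator {l..N} x *\<^sub>R (f x)\<^sup>2) = (\<lambda>x. indicator {l..} x *\<^sub>R (trunc N f x)\<^sup>2)"
    by (auto simp: indicator_def trunc_def)
  ultimately show "set_integrable lborel {l..} (\<lambda>x. (trunc N f x)\<^sup>2)" by (simp add: set_integrable_def)
qed

context nonneg_schrodinger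
begin

text \<open>On \<open>[l, N]\<close> the residual \<open>f\<close> of the projection of \<open>g\<close> onto \<open>h\<close> is orthogonal to \<open>h\<close>, so
  \<open>l(y) - z y = f\<close> has a solution with support in \<open>[l, N]\<close> and \<open>y(l) = 0\<close>. The lower bound of the
  Dirichlet extension controls \<open>y\<close>, hence also \<open>y'(l) = - \<parallel>f\<parallel>\<^sup>2\<close>, by \<open>\<parallel>f\<parallel>\<close>.\<close>

lemma minimal_solution_bound:
  assumes z: "z < 0"
    and h: "real_sol q l z h h'" "h l = 0" "h' l = 1"
    and g: "real_sol q l z g g'" "g l = -1" "g' l = 0"
  obtains K where "\<And>N. l \<le> N \<Longrightarrow> \<exists>m. (LINT x:{l..N}|lborel. (g x + m * h x)\<^sup>2) \<le> K"
proof -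
  \<comment> \<open>A comparison function with the data of \<open>g\<close> at \<open>l\<close>. It
    is chosen before N, which is why the bound \<open>K\<close> does not depend on N.\<close>
  obtain w r s where w: "real_dom q l w r s" "w l = -1" "r l = 0"
    by (rule real_dom_compact_support[OF q]) blast
  define Lw where "Lw = (\<lambda>x. real_lop q w s x + (- z) * w x)"
  have sw: "sq_int l w" "sq_int l (real_lop q w s)" using w(1) by (auto simp: real_dom_def)
  have sLw: "sq_int l Lw" unfolding Lw_def by (intro sq_int_add_cmult sw)
  define K where "K = 2 * (rip l w w + rip l Lw Lw / z\<^sup>2)"
  have ch: "continuous_on {l..} h" and cg: "continuous_on {l..} g"
    using h(1) g(1) by (auto simp: real_sol_def intro: primitive_continuous)
  have "\<exists>m. (LINT x:{l..N}|lborel. (g x + m * h x)\<^sup>2) \<le> K" if N: "l \<le> N" for N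
  proof -
    define A where "A = rip l (trunc N h) h"
    define B where "B = rip l (trunc N g) h"
    have th: "sq_int l (trunc N h)" "sq_int l (trunc N g)" by (intro sq_int_trunc ch cg)+
    have "B\<^sup>2 \<le> rip l (trunc N g) (trunc N g) * A"
      using rip_Cauchy_Schwarz[OF th(2,1)] by (simp add: A_def B_def rip_trunc_trunc)
    \<comment> \<open>The coefficient that makes g + m h orthogonal to \<open>h\<close> on [l, N].
      If A = 0, Cauchy-Schwarz gives B = 0 and any value works.\<close>
    then obtain m where m: "B + m * A = 0"
      by (cases "A = 0") (auto simp: that[of 0] intro: that[of "- B / A"])
    define f where "f = (\<lambda>x. g x + m * h x)"
    have cf: "continuous_on {l..} f" unfolding f_def by (intro continuous_intros ch cg)
    define F where "F = rip l (trunc N f) (trunc N f)"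
    have F: "F = (LINT x:{l..N}|lborel. (g x + m * h x)\<^sup>2)"
      unfolding F_def rip_trunc_trunc unfolding rip_trunc f_def by (simp add: power2_eq_square)
    have sf: "sq_int l (trunc N f)" by (rule sq_int_trunc[OF cf])
    have tf: "trunc N f = (\<lambda>x. trunc N g x + m * trunc N h x)" by (auto simp: trunc_def f_def)
    have fh: "rip l (trunc N f) h = 0"
    proof -
      have "rip l (trunc N f) (trunc N h) = B + m * A"
        unfolding tf rip_add_left[OF th(2,1,1)] by (simp add: A_def B_def rip_trunc_trunc)
      then show ?thesis using m by (simp add: rip_trunc_trunc)
    qed
    have fg: "rip l (trunc N f) g = F"
    proof -
      have "F = rip l (trunc N f) (trunc N g) + m * rip l (trunc N f) (trunc N h)"
        unfolding F_def using rip_add_right[OF th(2,1) sf, of m] by (simp add: tf)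
      then show ?thesis using fh by (simp add: rip_trunc_trunc)
    qed
    have "loc_int l (\<lambda>x. q x - z)" by (intro loc_int_diff q loc_int_continuous continuous_on_const)
    \<comment> \<open>With slope -F the boundary terms of the Lagrange identity beyond N vanish
      against \<open>g\<close> as well as against \<open>h\<close>; since these have Wronskian -1,
      \<open>y\<close> is zero there.\<close>
    then obtain y p where y: "y l = 0" "p l = - F" "primitive l y p"
        "primitive l p (\<lambda>t. (q t - z) * y t - trunc N f t)"
      by (rule linear_ode_exists[OF _ loc_int_trunc[OF cf]])
    define v where "v = (\<lambda>t. (q t - z) * y t - trunc N f t)"
    have Ly: "real_lop q y v = (\<lambda>x. trunc N f x + z * y x)"
      by (auto simp: real_lop_def v_def algebra_simps)
    have wr: "rip l (trunc N f) u = (p l * u l - y l * u' l) - (p x * u x - y x * u' x)"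
      if u: "real_sol q l z u u'" and x: "N \<le> x" for u u' x
    proof -
      have "rip l (trunc N f) u = (LINT t:{l..x}|lborel. trunc N f t * u t)"
        unfolding rip_trunc set_integral_trunc[OF x] ..
      also have "\<dots> = (LINT t:{l..x}|lborel. real_lop q y v t * u t -
          y t * real_lop q u (\<lambda>x. (q x - z) * u x) t)"
        unfolding Ly real_lop_sol by (simp add: algebra_simps)
      also have "\<dots> = (p l * u l - y l * u' l) - (p x * u x - y x * u' x)"
        by (rule lagrange_identity) (use u y N x in \<open>auto simp: real_sol_def v_def\<close>)
      finally show ?thesis .
    qed
    have zero: "y x = 0" if x: "N \<le> x" for x
    proof -
      have 1: "p x * h x = y x * h' x" using wr[OF h(1) x] fh h(2) y(1) by simp
      have 2: "p x * g x = y x * g' x" using wr[OF g(1) x] fg g(2) y(1,2) by simp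
      have 3: "h' x * g x - h x * g' x = - 1"
        using wronskian_const[OF h(1) g(1), of x] x N h g by simp
      have "y x = - (y x * (h' x * g x - h x * g' x))" by (simp add: 3)
      also have "\<dots> = - ((y x * h' x) * g x - h x * (y x * g' x))" by (simp add: algebra_simps)
      also have "\<dots> = 0" by (simp flip: 1 2)
      finally show ?thesis .
    qed
    have sy: "sq_int l y"
      by (rule sq_int_continuous_support[where N = N, OF primitive_continuous[OF y(3)]]) (simp add: zero)
    have dy: "real_dom q l y p v"
      using y sy sf by (simp add: real_dom_def Ly sq_int_add_cmult) (simp add: v_def)
    define Y where "Y = rip l y y"
    have Y: "0 \<le> Y" by (simp add: Y_def rip_self_nonneg)
    have F0: "0 \<le> F" by (simp add: F_def rip_self_nonneg)
    have "0 \<le> rip l (trunc N f) y + z * Y"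
      using dirichlet_nonneg[OF dy y(1)] by (simp add: Ly rip_add_left sf sy Y_def)
    then have "((- z) * Y)\<^sup>2 \<le> (rip l (trunc N f) y)\<^sup>2"
      using z Y by (intro power_mono) (auto simp: mult_nonpos_nonneg)
    also have "\<dots> \<le> F * Y" unfolding F_def Y_def by (rule rip_Cauchy_Schwarz[OF sf sy])
    finally have "Y * (z\<^sup>2 * Y) \<le> Y * F" by (simp add: power2_eq_square algebra_simps)
    then have YF: "z\<^sup>2 * Y \<le> F" using Y F0 by (cases "Y = 0") auto
    \<comment> \<open>Green's formula with w(l) = -1 and y(l) = 0 recovers F from the slope -F. Both
      pairings on the right are then at most of order sqrt F, so F^2 is bounded by a constant times
      F.\<close>
    have "F = rip l (real_lop q y v) w - rip l y (real_lop q w s)"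
      using green[OF dy w(1)] w y by simp
    also have "\<dots> = rip l (trunc N f) w - rip l y Lw"
      unfolding Ly Lw_def rip_add_left[OF sf sy sw(1)] rip_add_right[OF sw(2,1) sy] by simp
    finally have "F\<^sup>2 = (rip l (trunc N f) w - rip l y Lw)\<^sup>2" by simp
    also have "\<dots> \<le> 2 * (rip l (trunc N f) w)\<^sup>2 + 2 * (rip l y Lw)\<^sup>2"
      using zero_le_power2[of "rip l (trunc N f) w + rip l y Lw"]
      by (simp add: power2_eq_square algebra_simps)
    also have "\<dots> \<le> 2 * (F * rip l w w) + 2 * (Y * rip l Lw Lw)"
      unfolding F_def Y_def
      by (intro add_mono mult_left_mono rip_Cauchy_Schwarz sf sy sw sLw) auto
    also have "\<dots> \<le> 2 * (F * rip l w w) + 2 * (F / z\<^sup>2 * rip l Lw Lw)"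
      using YF z rip_self_nonneg[of l Lw]
      by (intro add_mono order_refl mult_left_mono mult_right_mono) (auto simp: field_simps)
    also have "\<dots> = F * K" by (simp add: K_def algebra_simps)
    finally have FK: "F * F \<le> F * K" by (simp add: power2_eq_square)
    have "0 \<le> K" using rip_self_nonneg[of l w] rip_self_nonneg[of l Lw] by (simp add: K_def)
    then have "F \<le> K" using FK F0 by (cases "F = 0") auto
    then show ?thesis unfolding F by blast
  qed
  then show ?thesis using that by blast
qed

text \<open>A real version of Weyl's nested discs: the coefficients whose norm on [l, l + n] stays
  below the uniform bound form nonempty, compact, decreasing sets, and a common point gives a square
  integrable solution.\<close>

lemma weyl_solution_exists:
  assumes z: "z < 0"
    and h: "real_sol q l z h h'" "h l = 0" "h' l = 1"
    and g: "real_sol q l z g g'" "g l = -1" "g' l = 0"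
  shows "\<exists>m. sq_int l (\<lambda>x. g x + m * h x)"
proof -
  have ch: "continuous_on {l..} h" and cg: "continuous_on {l..} g"
    using h(1) g(1) by (auto simp: real_sol_def intro: primitive_continuous)
  obtain K where K: "\<And>N. l \<le> N \<Longrightarrow> \<exists>m. (LINT x:{l..N}|lborel. (g x + m * h x)\<^sup>2) \<le> K"
    by (rule minimal_solution_bound[OF z h g]) blast
  define I where "I = (\<lambda>f n. LINT x:{l..l + real n}|lborel. f x :: real)"
  have i: "set_integrable lborel {l..N} (\<lambda>x. f x * f' x)"
    if "continuous_on {l..} f" "continuous_on {l..} f'" for f f' :: "real \<Rightarrow> real" and N
    by (intro loc_int_set_integrable loc_int_continuous continuous_intros that)
  have mono: "I (\<lambda>x. (f x)\<^sup>2) a \<le> I (\<lambda>x. (f x)\<^sup>2) b"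
    if "a \<le> b" and f: "continuous_on {l..} f" for a b :: nat and f :: "real \<Rightarrow> real"
    unfolding I_def set_lebesgue_integral_def
    by (rule integral_mono)
      (use i[OF f f] that in \<open>auto simp: set_integrable_def power2_eq_square indicator_def\<close>)
  have expand: "I (\<lambda>x. (g x + m * h x)\<^sup>2) n =
      I (\<lambda>x. g x * g x) n + 2 * m * I (\<lambda>x. g x * h x) n + m\<^sup>2 * I (\<lambda>x. h x * h x) n" for m n
  proof -
    have "I (\<lambda>x. (g x + m * h x)\<^sup>2) n =
        I (\<lambda>x. g x * g x + (2 * m * (g x * h x) + m\<^sup>2 * (h x * h x))) n"
      by (simp add: I_def power2_eq_square algebra_simps)
    then show ?thesis unfolding I_def
      by (simp add: set_integral_add i ch cg)
  qed
  have "\<exists>n. I (\<lambda>x. h x * h x) n \<noteq> 0"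
  proof (rule ccontr)
    assume "\<not> ?thesis"
    then have "sq_int l h"
      by (intro sq_int_of_bounded[OF ch, of 0]) (simp add: I_def power2_eq_square)
    then show False using no_negative_dirichlet_eigenvalue[OF h(1) _ h(2) z] h(3) by simp
  qed
  \<comment> \<open>From \<open>n0\<close> on, the coefficient of m^2 is positive, so the inequality
    defining \<open>S n\<close> is truly quadratic and has a bounded solution set.\<close>
  then obtain n0 where n0: "I (\<lambda>x. h x * h x) n0 \<noteq> 0" by blast
  define A where "A = (\<lambda>n. I (\<lambda>x. h x * h x) (n0 + n))"
  define B where "B = (\<lambda>n. I (\<lambda>x. g x * h x) (n0 + n))"
  define C where "C = (\<lambda>n. I (\<lambda>x. g x * g x) (n0 + n))"
  define S where "S = (\<lambda>n. {m. I (\<lambda>x. (g x + m * h x)\<^sup>2) (n0 + n) \<le> K})"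
  have S: "S n = {m. C n + 2 * m * B n + m\<^sup>2 * A n \<le> K}" for n
    unfolding S_def expand A_def B_def C_def ..
  have "0 \<le> I (\<lambda>x. h x * h x) n0"
    unfolding I_def set_lebesgue_integral_def by (rule integral_nonneg_AE) auto
  then have "0 < I (\<lambda>x. h x * h x) n0" using n0 by simp
  also have "I (\<lambda>x. h x * h x) n0 \<le> A n" for n
    using mono[OF _ ch, of n0 "n0 + n"] by (simp add: A_def power2_eq_square)
  finally have A: "0 < A n" for n .
  have "bounded (S n)" for n
  proof -
    \<comment> \<open>Completing the square turns membership in \<open>S n\<close> into (A m + B)^2
      \<le> R.\<close>
    define R where "R = A n * (K - C n) + (B n)\<^sup>2"
    have "\<bar>m\<bar> \<le> (R + 1 + \<bar>B n\<bar>) / A n" if "m \<in> S n" for m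
    proof -
      have "A n * (C n + 2 * m * B n + m\<^sup>2 * A n) \<le> A n * K"
        using that A[of n] by (intro mult_left_mono) (auto simp: S)
      then have "(A n * m + B n)\<^sup>2 \<le> R" by (simp add: R_def power2_eq_square algebra_simps)
      moreover have "\<bar>t\<bar> \<le> t\<^sup>2 + 1" for t :: real
      proof -
        have "2 * \<bar>t\<bar> \<le> t\<^sup>2 + 1"
          using zero_le_power2[of "\<bar>t\<bar> - 1"] unfolding power2_diff power2_abs by simp
        then show ?thesis using abs_ge_zero[of t] by linarith
      qed
      ultimately have "\<bar>A n * m + B n\<bar> \<le> R + 1"
        by (meson add_right_mono order_trans)
      then have "\<bar>A n * m\<bar> \<le> R + 1 + \<bar>B n\<bar>"
        using abs_triangle_ineq4[of "A n * m + B n" "B n"] by simp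
      then show ?thesis using A[of n] by (simp add: abs_mult field_simps)
    qed
    then show ?thesis unfolding bounded_iff real_norm_def by blast
  qed
  moreover have "closed (S n)" for n
    unfolding S by (intro closed_Collect_le continuous_intros)
  ultimately have comp: "compact (S n)" for n by (simp add: compact_eq_bounded_closed)
  have ne: "S n \<noteq> {}" for n using K[of "l + real (n0 + n)"] by (auto simp: S_def I_def)
  have sub: "S n \<subseteq> S m" if "m \<le> n" for m n
  proof
    fix t assume "t \<in> S n"
    moreover have "I (\<lambda>x. (g x + t * h x)\<^sup>2) (n0 + m) \<le> I (\<lambda>x. (g x + t * h x)\<^sup>2) (n0 + n)"
      using that by (intro mono continuous_intros ch cg) simp
    ultimately show "t \<in> S m" by (simp add: S_def)
  qed
  have "\<Inter> (range S) \<noteq> {}" by (rule compact_nest[OF comp ne sub])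
  then obtain m where m: "\<And>n. m \<in> S n" by blast
  have "sq_int l (\<lambda>x. g x + m * h x)"
  proof (rule sq_int_of_bounded)
    show c: "continuous_on {l..} (\<lambda>x. g x + m * h x)" by (intro continuous_intros ch cg)
    fix n
    have "I (\<lambda>x. (g x + m * h x)\<^sup>2) n \<le> I (\<lambda>x. (g x + m * h x)\<^sup>2) (n0 + n)"
      by (rule mono[OF _ c]) simp
    also have "\<dots> \<le> K" using m[of n] by (simp add: S_def)
    finally show "(LINT x:{l..l + real n}|lborel. (g x + m * h x)\<^sup>2) \<le> K" by (simp add: I_def)
  qed
  then show ?thesis by blast
qed

end

section \<open>Accretivity\<close>

lemma is_sol_iff:
  "is_sol q l (of_real z) y p \<longleftrightarrow>
    real_sol q l z (\<lambda>x. Re (y x)) (\<lambda>x. Re (p x)) \<and> real_sol q l z (\<lambda>x. Im (y x)) (\<lambda>x. Im (p x))"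
proof -
  let ?w = "\<lambda>t. (complex_of_real (q t) - of_real z) * y t"
  have "is_sol q l (of_real z) y p \<longleftrightarrow> (loc_int l p \<and> (\<forall>x\<ge>l. y x = y l + (LINT t:{l..x}|lborel. p t))) \<and>
     (loc_int l ?w \<and> (\<forall>x\<ge>l. p x = p l + (LINT t:{l..x}|lborel. ?w t)))"
    unfolding is_sol_def by blast
  then show ?thesis
    unfolding complex_primitive_iff real_sol_def by auto
qed

lemma primitive_zero: "primitive l (\<lambda>x. 0) (\<lambda>x. 0)"
  unfolding primitive_def using loc_int_continuous[OF continuous_on_const] by simp

lemma sq_int_zero: "sq_int l (\<lambda>x. 0)"
  by (rule sq_int_continuous_support) auto

lemma real_sol_zero: "real_sol q l z (\<lambda>x. 0) (\<lambda>x. 0)"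
  by (simp add: real_sol_def primitive_zero)

lemma real_dom_zero: "real_dom q l (\<lambda>x. 0) (\<lambda>x. 0) (\<lambda>x. 0)"
  using real_dom_sol[OF real_sol_zero sq_int_zero] by simp

section \<open>The state form on test functions\<close>

lemma dom_max_of_real:
  assumes "real_dom q l y p w"
  shows "dom_max q l (\<lambda>x. of_real (y x)) (\<lambda>x. of_real (p x)) (\<lambda>x. of_real (w x))"
    "Re (ip l (lop q (\<lambda>x. of_real (y x)) (\<lambda>x. of_real (w x))) (\<lambda>x. of_real (y x))) = rip l (real_lop q y w) y"
proof -
  show d: "dom_max q l (\<lambda>x. of_real (y x)) (\<lambda>x. of_real (p x)) (\<lambda>x. of_real (w x))"
    using assms by (simp add: dom_max_iff real_dom_zero)
  then have L: "L2 l (lop q (\<lambda>x. of_real (y x)) (\<lambda>x. of_real (w x)))" "L2 l (\<lambda>x. complex_of_real (y x))"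
    by (auto simp: dom_max_def)
  show "Re (ip l (lop q (\<lambda>x. of_real (y x)) (\<lambda>x. of_real (w x))) (\<lambda>x. of_real (y x))) = rip l (real_lop q y w) y"
    unfolding Re_Im_ip(1)[OF L] Re_Im_lop by (simp add: rip_def)
qed

text \<open>Multiplying by m^2 + 1 = |m - i|^2 clears the denominator and leaves a real quadratic
  form in y(l) and y'(l).\<close>

lemma Re_state_form:
  fixes m :: real
  shows "(m\<^sup>2 + 1) * Re (state_form q l (ereal m) \<i> y p w) =
    (m\<^sup>2 + 1) * Re (ip l (lop q y w) y) - (m\<^sup>2 - 1) * Re (p l * cnj (y l))
    + m * (cmod (p l))\<^sup>2 - m * (cmod (y l))\<^sup>2"
proof -
  define a where "a = y l"
  define b where "b = p l"
  have m: "m\<^sup>2 + 1 \<noteq> 0" by (metis add_nonneg_pos zero_le_power2 zero_less_one less_irrefl)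
  have "(complex_of_real m - \<i>) * (of_real m + \<i>) = of_real (m\<^sup>2 + 1)"
    by (simp add: algebra_simps power2_eq_square)
  then have "(b - \<i> * a) / (of_real m - \<i>) = (b - \<i> * a) * (of_real m + \<i>) / of_real (m\<^sup>2 + 1)"
    using m by (smt (verit) divide_divide_eq_left' mult.commute nonzero_mult_divide_mult_cancel_right of_real_eq_0_iff mult_zero_right mult_zero_left)
  then have "Re ((b - \<i> * a) / (of_real m - \<i>) * (of_real m * cnj a - cnj b)) =
      Re ((b - \<i> * a) * (of_real m + \<i>) * (of_real m * cnj a - cnj b)) / (m\<^sup>2 + 1)"
    by (simp only: times_divide_eq_left Re_divide_of_real)
  also have "Re ((b - \<i> * a) * (of_real m + \<i>) * (of_real m * cnj a - cnj b)) =
      (m\<^sup>2 - 1) * Re (b * cnj a) - m * (cmod b)\<^sup>2 + m * (cmod a)\<^sup>2"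
    unfolding cmod_power2 by (simp add: power2_eq_square algebra_simps)
  finally have "(m\<^sup>2 + 1) * Re ((b - \<i> * a) / (of_real m - \<i>) * (of_real m * cnj a - cnj b)) =
      (m\<^sup>2 - 1) * Re (b * cnj a) - m * (cmod b)\<^sup>2 + m * (cmod a)\<^sup>2"
    using m by simp
  then show ?thesis
    by (simp add: state_form_def Let_def right_diff_distrib flip: a_def b_def)
qed

lemma accretive_real_test:
  assumes acc: "accretive_Lsys q l (ereal m) \<i>" and y: "real_dom q l y p w"
  shows "0 \<le> (m\<^sup>2 + 1) * rip l (real_lop q y w) y - (m\<^sup>2 - 1) * (p l * y l) + m * (p l)\<^sup>2 - m * (y l)\<^sup>2"
proof -
  have "0 \<le> Re (state_form q l (ereal m) \<i> (\<lambda>x. of_real (y x)) (\<lambda>x. of_real (p x)) (\<lambda>x. of_real (w x)))"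
    using acc dom_max_of_real(1)[OF y] unfolding accretive_Lsys_def by blast
  then have "0 \<le> (m\<^sup>2 + 1) * Re (state_form q l (ereal m) \<i> (\<lambda>x. of_real (y x)) (\<lambda>x. of_real (p x)) (\<lambda>x. of_real (w x)))"
    by (intro mult_nonneg_nonneg) auto
  then show ?thesis unfolding Re_state_form dom_max_of_real(2)[OF y] by simp
qed

context nonneg_schrodinger
begin

text \<open>All solutions quantified over in \<open>m_inf\<close> agree on [l, infinity) with one
  real pair \<open>g\<close>, \<open>h\<close>, because imaginary parts have zero data. A second
  admissible coefficient would make a nonzero multiple of \<open>h\<close> square
  integrable.\<close>

lemma m_inf_negative:
  assumes z: "z < 0"
  obtains \<mu> u p where "m_inf q l (of_real z) = of_real \<mu>" "real_sol q l z u p" "u l = -1" "p l = \<mu>" "sq_int l u"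
proof -
  obtain h h' where h: "real_sol q l z h h'" "h l = 0" "h' l = 1" by (rule real_sol_exists[OF q])
  obtain g g' where g: "real_sol q l z g g'" "g l = -1" "g' l = 0" by (rule real_sol_exists[OF q])
  obtain \<mu> where \<mu>: "sq_int l (\<lambda>x. g x + \<mu> * h x)" using weyl_solution_exists[OF z h g] by blast
  have h_not: "\<not> sq_int l h"
    using no_negative_dirichlet_eigenvalue[OF h(1) _ h(2) z] h(3) by auto
  have "m_inf q l (of_real z) = of_real \<mu>"
    unfolding m_inf_def
  proof (rule the_equality)
    show "\<forall>\<phi>1 p1 \<phi>2 p2. is_sol q l (of_real z) \<phi>1 p1 \<and> \<phi>1 l = 0 \<and> p1 l = 1 \<and>
      is_sol q l (of_real z) \<phi>2 p2 \<and> \<phi>2 l = -1 \<and> p2 l = 0 \<longrightarrow> L2 l (\<lambda>x. \<phi>2 x + of_real \<mu> * \<phi>1 x)"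
    proof (intro allI impI)
      fix \<phi>1 p1 \<phi>2 p2
      assume a: "is_sol q l (of_real z) \<phi>1 p1 \<and> \<phi>1 l = 0 \<and> p1 l = 1 \<and>
        is_sol q l (of_real z) \<phi>2 p2 \<and> \<phi>2 l = -1 \<and> p2 l = 0"
      then have s: "real_sol q l z (\<lambda>x. Re (\<phi>1 x)) (\<lambda>x. Re (p1 x))"
        "real_sol q l z (\<lambda>x. Im (\<phi>1 x)) (\<lambda>x. Im (p1 x))"
        "real_sol q l z (\<lambda>x. Re (\<phi>2 x)) (\<lambda>x. Re (p2 x))"
        "real_sol q l z (\<lambda>x. Im (\<phi>2 x)) (\<lambda>x. Im (p2 x))"
        unfolding is_sol_iff by auto
      have e: "Re (\<phi>1 x) = h x" "Im (\<phi>1 x) = 0" "Re (\<phi>2 x) = g x" "Im (\<phi>2 x) = 0" if x: "l \<le> x" for x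
        using real_sol_unique[OF q s(1) h(1) _ _ x] real_sol_unique[OF q s(2) real_sol_zero _ _ x]
          real_sol_unique[OF q s(3) g(1) _ _ x] real_sol_unique[OF q s(4) real_sol_zero _ _ x] a h g
        by auto
      have "sq_int l (\<lambda>x. Re (\<phi>2 x + of_real \<mu> * \<phi>1 x))"
        using \<mu> by (subst sq_int_cong[where g = "\<lambda>x. g x + \<mu> * h x"]) (auto simp: e)
      moreover have "sq_int l (\<lambda>x. Im (\<phi>2 x + of_real \<mu> * \<phi>1 x))"
        using sq_int_zero by (subst sq_int_cong[where g = "\<lambda>x. 0"]) (auto simp: e)
      ultimately show "L2 l (\<lambda>x. \<phi>2 x + of_real \<mu> * \<phi>1 x)" unfolding L2_iff ..
    qed
  next
    fix m
    assume a: "\<forall>\<phi>1 p1 \<phi>2 p2. is_sol q l (of_real z) \<phi>1 p1 \<and> \<phi>1 l = 0 \<and> p1 l = 1 \<and>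
      is_sol q l (of_real z) \<phi>2 p2 \<and> \<phi>2 l = -1 \<and> p2 l = 0 \<longrightarrow> L2 l (\<lambda>x. \<phi>2 x + m * \<phi>1 x)"
    have "is_sol q l (of_real z) (\<lambda>x. of_real (h x)) (\<lambda>x. of_real (h' x))"
      "is_sol q l (of_real z) (\<lambda>x. of_real (g x)) (\<lambda>x. of_real (g' x))"
      using h g by (simp_all add: is_sol_iff real_sol_zero)
    then have "L2 l (\<lambda>x. of_real (g x) + m * of_real (h x))"
      by (intro a[rule_format]) (auto simp: h g)
    then have s: "sq_int l (\<lambda>x. g x + Re m * h x)" "sq_int l (\<lambda>x. Im m * h x)"
      unfolding L2_iff by simp_all
    have scale: "c = 0" if "sq_int l (\<lambda>x. c * h x)" for c
      using sq_int_cmult[OF that, of "inverse c"] h_not by (cases "c = 0") (auto simp flip: mult.assoc)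
    have "(\<lambda>x. (Re m - \<mu>) * h x) = (\<lambda>x. (g x + Re m * h x) + - 1 * (g x + \<mu> * h x))"
      by (auto simp: algebra_simps)
    then have "sq_int l (\<lambda>x. (Re m - \<mu>) * h x)" using sq_int_add_cmult[OF s(1) \<mu>, of "- 1"] by simp
    then show "m = of_real \<mu>" using scale s(2) by (force simp: complex_eq_iff)
  qed
  then show ?thesis
    by (rule that[OF _ real_sol_add_cmult[OF g(1) h(1), of \<mu>]]) (use g h \<mu> in simp_all)
qed

lemma form_lower_bound_negative:
  assumes z: "z < 0" and y: "real_dom q l y p w"
  shows "p l * y l + Re (m_inf q l (of_real z)) * (y l)\<^sup>2 + z * rip l y y \<le> rip l (real_lop q y w) y"
proof -
  obtain \<mu> u r where u: "m_inf q l (of_real z) = of_real \<mu>" "real_sol q l z u r" "u l = -1" "r l = \<mu>" "sq_int l u"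
    by (rule m_inf_negative[OF z])
  note du = real_dom_sol[OF u(2,5)]
  define a where "a = y l"
  have s: "sq_int l y" "sq_int l (real_lop q y w)" "sq_int l (\<lambda>x. z * u x)"
    using y u(5) by (auto simp: real_dom_def sq_int_cmult)
  have G: "rip l (real_lop q y w) u = z * rip l y u - p l - a * \<mu>"
    using green[OF y du] u(3,4) by (simp add: real_lop_sol rip_commute[of l y] rip_cmult_left a_def)
  have "0 \<le> rip l (\<lambda>x. real_lop q y w x + a * (z * u x)) (\<lambda>x. y x + a * u x)"
    using dirichlet_nonneg[OF real_dom_add_cmult[OF y du, of a]] u(3)
    by (simp add: a_def real_lop_add_cmult real_lop_sol)
  also have "\<dots> = rip l (real_lop q y w) y + a * rip l (real_lop q y w) u
      + a * (z * rip l y u) + a\<^sup>2 * z * rip l u u"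
    by (simp only: rip_add_left rip_add_right s u(5) sq_int_add_cmult rip_cmult_left)
      (simp add: rip_commute[of l u y] power2_eq_square algebra_simps)
  finally have 1: "0 \<le> rip l (real_lop q y w) y - a * p l - a\<^sup>2 * \<mu>
      + z * (2 * a * rip l y u + a\<^sup>2 * rip l u u)"
    unfolding G by (simp add: power2_eq_square algebra_simps)
  \<comment> \<open>The terms that still contain \<open>u\<close> are completed to z times the
    squared norm of y + a u, which is at most 0 as z < 0; the price is z times the squared norm of
    \<open>y\<close>.\<close>
  have "0 \<le> rip l (\<lambda>x. y x + a * u x) (\<lambda>x. y x + a * u x)" by (rule rip_self_nonneg)
  also have "\<dots> = rip l y y + (2 * a * rip l y u + a\<^sup>2 * rip l u u)"
    by (simp only: rip_add_left rip_add_right s u(5) sq_int_add_cmult)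
      (simp add: rip_commute[of l u y] power2_eq_square algebra_simps)
  finally have "z * (rip l y y + (2 * a * rip l y u + a\<^sup>2 * rip l u u)) \<le> 0"
    using z by (simp add: mult_nonpos_nonneg)
  then show ?thesis
    using 1 unfolding u(1) a_def[symmetric] by (simp add: algebra_simps)
qed

lemma form_lower_bound:
  assumes M: "((\<lambda>x. m_inf q l (of_real x)) \<longlongrightarrow> of_real M) (at_left 0)" and y: "real_dom q l y p w"
  shows "p l * y l + M * (y l)\<^sup>2 \<le> rip l (real_lop q y w) y"
proof (rule tendsto_upperbound)
  have "((\<lambda>x. p l * y l + Re (m_inf q l (of_real x)) * (y l)\<^sup>2 + x * rip l y y)
      \<longlongrightarrow> p l * y l + Re (of_real M) * (y l)\<^sup>2 + 0 * rip l y y) (at_left 0)"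
    by (intro tendsto_intros M)
  then show "((\<lambda>x. p l * y l + Re (m_inf q l (of_real x)) * (y l)\<^sup>2 + x * rip l y y)
      \<longlongrightarrow> p l * y l + M * (y l)\<^sup>2) (at_left 0)" by simp
  show "\<forall>\<^sub>F x in at_left 0. p l * y l + Re (m_inf q l (of_real x)) * (y l)\<^sup>2 + x * rip l y y
      \<le> rip l (real_lop q y w) y"
    using form_lower_bound_negative[OF _ y] by (simp add: eventually_at_filter)
qed simp

lemma complex_form_lower_bound:
  assumes M: "((\<lambda>x. m_inf q l (of_real x)) \<longlongrightarrow> of_real M) (at_left 0)" and d: "dom_max q l y p w"
  shows "Re (p l * cnj (y l)) + M * (cmod (y l))\<^sup>2 \<le> Re (ip l (lop q y w) y)"
proof -
  have L: "L2 l (lop q y w)" "L2 l y" using d by (auto simp: dom_max_def)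
  show ?thesis
    using form_lower_bound[OF M, of "\<lambda>x. Re (y x)"] form_lower_bound[OF M, of "\<lambda>x. Im (y x)"] d
    unfolding dom_max_iff Re_Im_ip(1)[OF L] Re_Im_lop
    by (fastforce simp: cmod_power2 algebra_simps)
qed

text \<open>For h = i the term i |y(l)|^2 has no real part. The remaining boundary term cancels
  against the lower bound up to M |y(l)|^2.\<close>

lemma accretive_infinity:
  assumes M: "((\<lambda>x. m_inf q l (of_real x)) \<longlongrightarrow> of_real M) (at_left 0)" "0 \<le> M"
  shows "accretive_Lsys q l \<infinity> \<i>"
  unfolding accretive_Lsys_def
proof (intro allI impI)
  fix y p w
  assume d: "dom_max q l y p w"
  have "0 \<le> M * (cmod (y l))\<^sup>2" using M(2) by simp
  then show "0 \<le> Re (state_form q l \<infinity> \<i> y p w)"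
    using complex_form_lower_bound[OF M(1) d] by (simp add: state_form_def algebra_simps)
qed

lemma accretive_if:
  fixes m :: real
  assumes M: "((\<lambda>x. m_inf q l (of_real x)) \<longlongrightarrow> of_real M) (at_left 0)" "0 \<le> M" and m: "1 \<le> M * m"
  shows "accretive_Lsys q l (ereal m) \<i>"
  unfolding accretive_Lsys_def
proof (intro allI impI)
  fix y p w
  assume d: "dom_max q l y p w"
  define a b where "a = y l" and "b = p l"
  have m0: "0 < m" using m M(2) by (smt (verit) mult_nonneg_nonpos)
  have mm: "0 < m\<^sup>2 + 1" by (simp add: add_nonneg_pos)
  \<comment> \<open>The boundary form multiplied by m > 0, with the square in \<open>b\<close>
    completed; the coefficient left over is the determinant.\<close>
  have "0 \<le> (cmod (of_real m * b + a))\<^sup>2 + (m\<^sup>2 + 1) * (M * m - 1) * (cmod a)\<^sup>2"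
    using m mm by simp
  also have "\<dots> = m * (2 * Re (b * cnj a) + m * (cmod b)\<^sup>2 - m * (cmod a)\<^sup>2 + (m\<^sup>2 + 1) * M * (cmod a)\<^sup>2)"
    unfolding cmod_power2 by (simp add: power2_eq_square algebra_simps)
  finally have "0 \<le> 2 * Re (b * cnj a) + m * (cmod b)\<^sup>2 - m * (cmod a)\<^sup>2 + (m\<^sup>2 + 1) * M * (cmod a)\<^sup>2"
    using m0 by (simp only: zero_le_mult_iff) auto
  also have "\<dots> = (m\<^sup>2 + 1) * (Re (b * cnj a) + M * (cmod a)\<^sup>2)
      - (m\<^sup>2 - 1) * Re (b * cnj a) + m * (cmod b)\<^sup>2 - m * (cmod a)\<^sup>2"
    by (simp add: algebra_simps del: complex_cnj_cancel_iff)
  also have "\<dots> \<le> (m\<^sup>2 + 1) * Re (state_form q l (ereal m) \<i> y p w)"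
    unfolding Re_state_form a_def b_def
    using mult_left_mono[OF complex_form_lower_bound[OF M(1) d] less_imp_le[OF mm]] by linarith
  finally show "0 \<le> Re (state_form q l (ereal m) \<i> y p w)"
    using mm by (simp add: zero_le_mult_iff)
qed

text \<open>Negative \<open>m\<close> is excluded by the bumps of small energy, the other values with \<open>M m < 1\<close> by
  the Weyl solutions, in the limit \<open>z \<rightarrow> 0\<close>.\<close>

lemma accretive_only_if:
  fixes m :: real
  assumes M: "((\<lambda>x. m_inf q l (of_real x)) \<longlongrightarrow> of_real M) (at_left 0)" "0 \<le> M"
    and acc: "accretive_Lsys q l (ereal m) \<i>"
  shows "1 \<le> M * m"
proof (rule ccontr)
  assume "\<not> 1 \<le> M * m"
  then have Mm: "M * m < 1" by simp
  have mm: "0 < m\<^sup>2 + 1" by (simp add: add_nonneg_pos)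
  \<comment> \<open>\<open>U\<close> is the squared norm of the Weyl solution. The first inequality
    is the accretivity test on it, where its boundary form factors; the second is the lower bound on
    the same function.\<close>
  have weyl: "\<exists>U. 0 < U \<and> 0 \<le> (m * \<mu> - 1) * (\<mu> + m) + (m\<^sup>2 + 1) * (z * U) \<and> M \<le> \<mu> + z * U"
    if z: "z < 0" and \<mu>: "\<mu> = Re (m_inf q l (of_real z))" for z \<mu>
  proof -
    obtain u p where u: "real_sol q l z u p" "u l = -1" "p l = \<mu>" "sq_int l u"
      using m_inf_negative[OF z] \<mu> by (metis Re_complex_of_real)
    note d = real_dom_sol[OF u(1,4)]
    have "rip l u u \<noteq> 0" using sol_norm_zero[OF u(1,4)] u(2) by auto
    then have "0 < rip l u u" using rip_self_nonneg[of l u] by simp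
    moreover have "0 \<le> (m * \<mu> - 1) * (\<mu> + m) + (m\<^sup>2 + 1) * (z * rip l u u)"
      using accretive_real_test[OF acc d] unfolding real_lop_sol rip_cmult_left u(2,3)
      by (simp add: power2_eq_square algebra_simps)
    moreover have "M \<le> \<mu> + z * rip l u u"
      using form_lower_bound[OF M(1) d] u(2,3) by (simp add: real_lop_sol rip_cmult_left)
    ultimately show ?thesis by blast
  qed
  consider "m < 0" | "m = 0" | "0 < m" by linarith
  then show False
  proof cases
    case 1
    \<comment> \<open>For m < 0 the factor M + m may be negative too, so the Weyl test need not
      fail. On a function with value 0 and slope 1 at \<open>l\<close> the tested form is m plus
      (m^2 + 1) times its energy.\<close>
    then have "0 < - m / (m\<^sup>2 + 1)" using mm by (intro divide_pos_pos) simp_all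
    then obtain v r s where v: "real_dom q l v r s" "v l = 0" "r l = 1"
        "rip l (real_lop q v s) v < - m / (m\<^sup>2 + 1)"
      by (rule real_dom_small_bump[OF q])
    then have "(m\<^sup>2 + 1) * rip l (real_lop q v s) v < - m"
      using mm by (simp add: field_simps)
    then show False using accretive_real_test[OF acc v(1)] v(2,3) by simp
  next
    case 2
    \<comment> \<open>In the limit z to 0 the test would only give M \<le> 0, which M = 0 satisfies.
      At a fixed z, adding the two inequalities yields M \<le> -2 U < 0.\<close>
    obtain U where "0 < U" "0 \<le> - Re (m_inf q l (of_real (- 1))) - U" "M \<le> Re (m_inf q l (of_real (- 1))) - U"
      using weyl[of "- 1", OF _ refl] 2 by auto
    then show False using M(2) by linarith
  next
    case 3
    \<comment> \<open>Only the sign of \<open>x * U\<close> enters, so the norms of the Weyl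
      solutions may grow as x tends to 0.\<close>
    have "0 \<le> (m * M - 1) * (M + m)"
    proof (rule tendsto_lowerbound)
      have "((\<lambda>x. (m * Re (m_inf q l (of_real x)) - 1) * (Re (m_inf q l (of_real x)) + m))
          \<longlongrightarrow> (m * Re (of_real M) - 1) * (Re (of_real M) + m)) (at_left 0)"
        by (intro tendsto_intros M)
      then show "((\<lambda>x. (m * Re (m_inf q l (of_real x)) - 1) * (Re (m_inf q l (of_real x)) + m))
          \<longlongrightarrow> (m * M - 1) * (M + m)) (at_left 0)" by simp
      have "0 \<le> (m * Re (m_inf q l (of_real x)) - 1) * (Re (m_inf q l (of_real x)) + m)" if x: "x < 0" for x
      proof -
        obtain U where U: "0 < U" "0 \<le> (m * Re (m_inf q l (of_real x)) - 1) * (Re (m_inf q l (of_real x)) + m)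
            + (m\<^sup>2 + 1) * (x * U)"
          using weyl[OF x refl] by blast
        have "(m\<^sup>2 + 1) * (x * U) \<le> 0" using x U(1) mm by (simp add: mult_nonneg_nonpos mult_nonpos_nonneg)
        then show ?thesis using U(2) by linarith
      qed
      then show "\<forall>\<^sub>F x in at_left 0.
          0 \<le> (m * Re (m_inf q l (of_real x)) - 1) * (Re (m_inf q l (of_real x)) + m)"
        by (simp add: eventually_at_filter)
    qed simp
    moreover have "(m * M - 1) * (M + m) < 0"
      using 3 Mm M(2) by (intro mult_neg_pos) (auto simp: mult.commute)
    ultimately show False by simp
  qed
qed

end

theorem theorem12:
  fixes q :: "real \<Rightarrow> real" and l :: real and \<alpha> :: real and M :: real
  assumes "0 \<le> l"
    and "loc_int l q"
    and "deficiency_1_1 q l"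
    and "nonneg_min q l"
    and "((\<lambda>x. m_inf q l (complex_of_real x)) \<longlongrightarrow> complex_of_real M) (at_left 0)"
    and "0 \<le> M"
    and "0 < \<alpha>" and "\<alpha> \<le> pi"
  shows "accretive_Lsys q l (tan_ext \<alpha>) \<i> \<longleftrightarrow> recip_ext M \<le> tan_ext \<alpha>"
proof -
  interpret nonneg_schrodinger q l by unfold_locales fact+
  show ?thesis
  proof (cases "cos \<alpha> = 0")
    case True
    then show ?thesis using accretive_infinity[OF assms(5,6)] by (simp add: tan_ext_def)
  next
    case False
    have "accretive_Lsys q l (ereal (tan \<alpha>)) \<i> \<longleftrightarrow> 1 \<le> M * tan \<alpha>"
      using accretive_if[OF assms(5,6)] accretive_only_if[OF assms(5,6)] by blast
    \<comment> \<open>For M = 0 both sides are false, since the reciprocal is infinite and the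
      tangent finite.\<close>
    also have "\<dots> \<longleftrightarrow> recip_ext M \<le> ereal (tan \<alpha>)"
      using \<open>0 \<le> M\<close> by (cases "M = 0") (auto simp: recip_ext_def field_simps)
    finally show ?thesis using False by (simp add: tan_ext_def)
  qed
qed

end
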